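(* Let $1<p<2$ and let $\{X_n;\,n\ge1\}$ be a sequence of independent copies of a $\mathbf{B}$-valued random variable $X$, with $S_n=\sum_{k=1}^n X_k$. Then \[ \sum_{n=1}^{\infty}\frac1n\left(\frac{\mathbb{E}\|S_n\|}{n^{1/p}}\right)<\infty \quad (\ast) \] if and only if \[ \sum_{n=1}^{\infty}\frac1n\left(\frac{\|S_n\|}{n^{1/p}}\right)<\infty\ \text{ almost surely}. \quad (\ast\ast) \] Furthermore, each of $(\ast)$ and $(\ast\ast)$ implies both \[ \mathbb{E}X=0\quad\text{and}\quad \int_0^\infty \mathbb{P}^{1/p}(\|X\|>t)\,dt<\infty, \] and \[ \lim_{n\to\infty}\frac{S_n}{n^{1/p}}=0\ \text{ almost surely}. \]
   Context: $(\mathbf{B},\|\cdot\|)$ is a real separable Banach space with its Borel $\sigma$-algebra; all random variables are defined on a probability space $(\Omega,\mathcal F,\mathbb P)$. The expected value $\mathbb{E}X$ of a $\mathbf B$-valued random variable $X$ is the Pettis integral: $\mathbb{E}X\in\mathbf B$ is the element with $\varphi(\mathbb{E}X)=\mathbb{E}\varphi(X)$ for every continuous linear functional $\varphi$ on $\mathbf B$ (it exists in particular when $\mathbb{E}\|X\|<\infty$). $\mathbb{P}^{1/p}(A)$ denotes $(\mathbb P(A))^{1/p}$. *)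

theory Defs
  imports "HOL-Probability.Probability"
begin

text \<open>Partial sums: psum Xs n = X_1 + ... + X_n, where the sequence is indexed from 0,
  i.e. X_{k+1} is represented by Xs k.\<close>
definition psum :: "(nat \<Rightarrow> 'a \<Rightarrow> 'b::real_normed_vector) \<Rightarrow> nat \<Rightarrow> 'a \<Rightarrow> 'b" where
  "psum Xs n \<omega> = (\<Sum>k<n. Xs k \<omega>)"

end

theory Submission
  imports Defs
begin

text \<open>Write a = 1/p, S n for the partial sums and V for the random series in question. If V is finite
  almost surely, then V is at most K outside a small event, and integrating V over the event V \<le> K
  bounds a weighted sum of high quantiles of the norms of the S n. As S j has the law of S (n+j) - S n,
  averaging over n in a window turns these quantiles into bounds r m that serve all j \<le> m at once and
  are still summable against the weights. Ottaviani's inequality then controls the running maximum by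
  2 r m with probability 1/2, hence the tail of the norm of X at 4 r m by 1/m. The latter yields the
  integral condition; combined with a Hoffmann-Joergensen inequality it bounds the expected running
  maxima, and their weighted sum is finite. As running maxima are monotone, finiteness of their
  weighted sum forces the strong law pathwise.\<close>

section \<open>Weighted series\<close>

text \<open>The obstacle is that almost sure finiteness of the series brings no moment with it:
  neither the partial sums nor X are known to be integrable, so quantiles have to stand in for means
  until the tail of X is under control. Symmetry, the usual means of passing from the tail of one
  sum to that of smaller ones, is absent as well; stationarity of the increments takes its place.
  With n in [m, 2m) and j at most m, both n and n + j lie in [m, 3m), where the weights are
  comparable to the weight of m, so the averaging costs only a constant factor.

  The probabilities are budgeted backwards from 1/2. Ottaviani's inequality doubles the level, and
  so does the difference of two sums, hence the start at 1/8. The final 1/2 is used twice: it is the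
  factor absorbed in the bound for the expected maxima, and it exceeds exp(-1), which gives the tail
  bound for X.

  The assumption p > 1, that is a < 1, enters where the sum of m powr (-a) over m up to N must have
  order N powr (1-a), and where m powr (1-a) must stay away from 0, so that the mean
  vanishes.\<close>

lemma ennreal_suminf_swap:
  fixes f :: "nat \<Rightarrow> nat \<Rightarrow> ennreal"
  shows "(\<Sum>m. \<Sum>n. f m n) = (\<Sum>n. \<Sum>m. f m n)"
proof -
  have "(\<Sum>m. \<Sum>n. f m n) = (\<Sum>m. \<integral>\<^sup>+n. f m n \<partial>count_space UNIV)"
    by (simp add: nn_integral_count_space_nat)
  also have "\<dots> = (\<integral>\<^sup>+n. (\<Sum>m. f m n) \<partial>count_space UNIV)"
    by (rule nn_integral_suminf[symmetric]) simp
  finally show ?thesis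
    by (simp add: nn_integral_count_space_nat)
qed

lemma ennreal_suminf_Suc:
  fixes f :: "nat \<Rightarrow> ennreal"
  assumes "f 0 = 0"
  shows "(\<Sum>n. f (Suc n)) = (\<Sum>n. f n)"
  using suminf_offset[of f 1] assms by (simp add: summableI)

lemma nn_integral_indicator_Ico:
  "(\<integral>\<^sup>+ t. indicator {a..<b::real} t \<partial>lborel) = ennreal (b - a)"
  by (cases "a \<le> b") (simp_all add: ennreal_neg)

text \<open>Absorption of a half of \<open>x\<close> into the left side. Finiteness of
  \<open>x\<close> is what permits the subtraction; when the lemma is applied to the expected
  running maximum, it has to be secured beforehand.\<close>

lemma ennreal_le_twice:
  fixes x z :: ennreal
  assumes "x < \<infinity>" "x \<le> z + ennreal (1 / 2) * x"
  shows "x \<le> 2 * z"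
proof (cases z)
  case (real w)
  obtain y where y: "x = ennreal y" "0 \<le> y" using assms(1) by (cases x) auto
  have "ennreal y \<le> ennreal (w + 1 / 2 * y)"
    using assms(2) y real by (simp only: ennreal_plus ennreal_mult mult_nonneg_nonneg zero_le_divide_1_iff zero_le_numeral)
  then have "y \<le> 2 * w" using y real by (subst (asm) ennreal_le_iff) auto
  then have "ennreal y \<le> ennreal (2 * w)" by (rule ennreal_leI)
  then show ?thesis using y real by (simp add: ennreal_mult)
qed (simp add: ennreal_mult_top)

text \<open>With \<open>a = 1 / p\<close> this is the product of the factors 1/n and 1/n^(1/p) of
  the series. Since \<open>0 powr x = 0\<close>, the weight of 0 vanishes, and series over n \<ge> 1
  can be summed over all naturals.\<close>

definition wt :: "real \<Rightarrow> nat \<Rightarrow> real" where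
  "wt a n = real n powr (- 1 - a)"

lemma wt_nonneg [simp]: "0 \<le> wt a n"
  by (simp add: wt_def)

lemma wt_0 [simp]: "wt a 0 = 0"
  by (simp add: wt_def)

text \<open>The block has \<open>N\<close> terms, each at least (2N)^(-1-a). The constant 4 comes
  from 2^(-1-a) \<ge> 2^(-2), valid as a \<le> 1.\<close>

lemma wt_block_sum:
  assumes "0 \<le> a" "a \<le> 1" "1 \<le> N"
  shows "real N powr (- a) / 4 \<le> (\<Sum>n=N..<2*N. wt a n)"
proof -
  have "real N powr (- a) / 4 = real N * ((1/4) * real N powr (- 1 - a))"
    using assms powr_add[of "real N" 1 "-1-a"] by simp
  also have "\<dots> \<le> real N * (2 * real N) powr (- 1 - a)"
  proof -
    have "(2::real) powr (-2) \<le> 2 powr (- 1 - a)"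
      using assms by (intro powr_mono) auto
    moreover have "(2::real) powr (-2) = 1 / 4" by (simp add: powr_minus)
    ultimately have "(1/4) * real N powr (- 1 - a) \<le> 2 powr (- 1 - a) * real N powr (- 1 - a)"
      by (intro mult_right_mono) auto
    then show ?thesis using assms by (intro mult_left_mono) (auto simp: powr_mult)
  qed
  also have "\<dots> = (\<Sum>n=N..<2*N. (2 * real N) powr (- 1 - a))"
    by simp
  also have "\<dots> \<le> (\<Sum>n=N..<2*N. wt a n)"
    unfolding wt_def using assms by (intro sum_mono powr_mono2') auto
  finally show ?thesis .
qed

lemma wt_block_suminf:
  fixes f :: "nat \<Rightarrow> ennreal"
  assumes "0 \<le> a" "a \<le> 1" "1 \<le> N" and "\<And>n. N \<le> n \<Longrightarrow> f n = ennreal (wt a n)"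
  shows "ennreal (real N powr (- a)) \<le> 4 * (\<Sum>n. f n)"
proof -
  have "ennreal (real N powr (- a)) = 4 * ennreal (real N powr (- a) / 4)"
    by (simp add: ennreal_mult'[symmetric] flip: ennreal_numeral)
  also have "ennreal (real N powr (- a) / 4) \<le> ennreal (\<Sum>n=N..<2*N. wt a n)"
    using wt_block_sum[OF assms(1-3)] by (rule ennreal_leI)
  also have "\<dots> = (\<Sum>n=N..<2*N. f n)"
    using assms(4) by (simp flip: sum_ennreal)
  also have "\<dots> \<le> (\<Sum>n. f n)"
    by (rule sum_le_suminf) (auto simp: summableI)
  finally show ?thesis by (simp add: mult_left_mono)
qed

text \<open>Comparison with the integral of x^(-a), done by telescoping: each new term is at most
  the increment of x^(1-a)/(1-a). The mean value theorem needs differentiability only in the open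
  interval, which matters for the first increment, starting at 0.\<close>

lemma sum_powr_minus_le:
  assumes "0 < a" "a < 1"
  shows "(\<Sum>m=1..N. real m powr (- a)) \<le> real N powr (1 - a) / (1 - a)"
proof (induction N)
  case 0
  then show ?case by simp
next
  case (Suc N)
  have "\<exists>z. real N < z \<and> z < real (Suc N) \<and>
      real (Suc N) powr (1 - a) - real N powr (1 - a) = (1 - a) * z powr (- a)"
  proof -
    have "\<exists>l z. real N < z \<and> z < real (Suc N) \<and> DERIV (\<lambda>x. x powr (1 - a)) z :> l \<and>
        real (Suc N) powr (1 - a) - real N powr (1 - a) = (real (Suc N) - real N) * l"
    proof (rule MVT)
      show "continuous_on {real N..real (Suc N)} (\<lambda>x. x powr (1 - a))"
        using assms by (intro continuous_on_powr') (auto intro!: continuous_intros)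
      fix x assume "real N < x"
      then have "0 < x" using of_nat_0_le_iff[of N, where 'a=real] by linarith
      then show "(\<lambda>x. x powr (1 - a)) differentiable (at x)"
        by (auto intro!: derivative_eq_intros simp: real_differentiable_def)
    qed simp
    then obtain l z where z: "real N < z" "z < real (Suc N)" 
      and l: "DERIV (\<lambda>x. x powr (1 - a)) z :> l"
      and e: "real (Suc N) powr (1 - a) - real N powr (1 - a) = l" by auto
    have "0 < z" using z(1) of_nat_0_le_iff[of N, where 'a=real] by linarith
    then have "DERIV (\<lambda>x. x powr (1 - a)) z :> (1 - a) * z powr (- a)"
      by (auto intro!: derivative_eq_intros)
    then have "l = (1 - a) * z powr (- a)" using l DERIV_unique by blast
    with z e show ?thesis by auto
  qed
  then obtain z where z: "real N < z" "z < real (Suc N)" 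
    "real (Suc N) powr (1 - a) - real N powr (1 - a) = (1 - a) * z powr (- a)" by blast
  have "0 < z" using z(1) of_nat_0_le_iff[of N, where 'a=real] by linarith
  then have "real (Suc N) powr (- a) \<le> z powr (- a)"
    using z assms by (intro powr_mono2') auto
  then have "real (Suc N) powr (- a) \<le> (real (Suc N) powr (1 - a) - real N powr (1 - a)) / (1 - a)"
    using z(3) assms by simp
  then show ?case using Suc by (simp add: diff_divide_distrib)
qed

text \<open>Exchange the two summations. A fixed \<open>n\<close> lies in the window of
  \<open>m\<close> only if n/3 < m \<le> n; for such \<open>m\<close> the weight is at most 3^(1+a)
  \<le> 9 times that of \<open>n\<close>, and 2/m is at most 6/n. At most \<open>n\<close> values of
  \<open>m\<close> occur, which cancels the 1/n and leaves 9 * 6 = 54.\<close>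

lemma suminf_wt_window_average_le:
  fixes q :: "nat \<Rightarrow> real"
  assumes a: "0 \<le> a" "a \<le> 1" and q: "\<And>n. 0 \<le> q n"
  shows "(\<Sum>m. ennreal (wt a m * (2 / real m * (\<Sum>n=m..<3*m. q n))))
    \<le> 54 * (\<Sum>n. ennreal (wt a n * q n))"
proof -
  define c where "c m n = (if m \<le> n \<and> n < 3 * m then wt a m * (2 / real m) * q n else 0)" for m n
  have c0: "0 \<le> c m n" for m n using q by (simp add: c_def)
  have row: "ennreal (wt a m * (2 / real m * (\<Sum>n=m..<3*m. q n))) = (\<Sum>n. ennreal (c m n))" for m
  proof -
    have "(\<Sum>n. ennreal (c m n)) = (\<Sum>n\<in>{m..<3*m}. ennreal (c m n))"
      by (rule suminf_finite) (auto simp: c_def)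
    also have "\<dots> = ennreal (\<Sum>n\<in>{m..<3*m}. c m n)"
      using c0 by (simp add: sum_ennreal)
    also have "(\<Sum>n\<in>{m..<3*m}. c m n) = wt a m * (2 / real m * (\<Sum>n=m..<3*m. q n))"
      by (simp add: c_def sum_distrib_left mult.assoc)
    finally show ?thesis ..
  qed
  have col: "(\<Sum>m. ennreal (c m n)) \<le> 54 * ennreal (wt a n * q n)" for n
  proof -
    have term_le: "c m n \<le> 54 / real n * (wt a n * q n)" if "m \<in> {1..n}" for m
    proof (cases "m \<le> n \<and> n < 3 * m")
      case True
      have n: "real n / 3 \<le> real m" "0 < real m" "0 < real n" using True that by auto
      have "wt a m \<le> (real n / 3) powr (- 1 - a)"
        unfolding wt_def using n a by (intro powr_mono2') auto
      also have "\<dots> = 3 powr (1 + a) * wt a n"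
        using powr_minus_divide[of 3 "1 + a"] by (simp add: wt_def powr_divide)
      also have "\<dots> \<le> 9 * wt a n"
        using a powr_mono[of "1 + a" 2 "3::real"] by (intro mult_right_mono) auto
      finally have 1: "wt a m \<le> 9 * wt a n" .
      have 2: "2 / real m \<le> 6 / real n" using n by (simp add: field_simps)
      have "c m n \<le> (9 * wt a n) * (6 / real n) * q n"
        unfolding c_def if_P[OF True] by (intro mult_right_mono mult_mono 1 2 q) auto
      then show ?thesis by (simp add: mult_ac)
    next
      case False
      then have "c m n = 0" by (auto simp: c_def)
      then show ?thesis using q by simp
    qed
    have "(\<Sum>m. ennreal (c m n)) = (\<Sum>m\<in>{1..n}. ennreal (c m n))"
      by (rule suminf_finite) (auto simp: c_def)
    also have "\<dots> = ennreal (\<Sum>m\<in>{1..n}. c m n)"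
      using c0 by (simp add: sum_ennreal)
    also have "\<dots> \<le> ennreal (\<Sum>m\<in>{1..n}. 54 / real n * (wt a n * q n))"
      by (intro ennreal_leI sum_mono term_le)
    also have "\<dots> \<le> ennreal (54 * (wt a n * q n))"
      using q by (intro ennreal_leI) auto
    also have "\<dots> = 54 * ennreal (wt a n * q n)"
      using q by (simp add: ennreal_mult)
    finally show ?thesis .
  qed
  have "(\<Sum>m. ennreal (wt a m * (2 / real m * (\<Sum>n=m..<3*m. q n)))) = (\<Sum>m. \<Sum>n. ennreal (c m n))"
    by (simp only: row)
  also have "\<dots> = (\<Sum>n. \<Sum>m. ennreal (c m n))"
    by (rule ennreal_suminf_swap)
  also have "\<dots> \<le> (\<Sum>n. 54 * ennreal (wt a n * q n))"
    by (intro suminf_le col) (auto simp: summableI)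
  finally show ?thesis by simp
qed

text \<open>Since f (s m) is at most 1/m, every m above 1 / f t satisfies t < s m, and the
  weights of these m add up to at least a multiple of f t powr a.\<close>
lemma nn_integral_tail_powr_le:
  fixes f :: "real \<Rightarrow> real"
  assumes a: "0 < a" "a \<le> 1"
    and anti: "\<And>x y. x \<le> y \<Longrightarrow> f y \<le> f x" and f: "\<And>x. 0 \<le> f x" "\<And>x. f x \<le> 1"
    and s: "\<And>m. 0 \<le> s m" and fs: "\<And>m. 1 \<le> m \<Longrightarrow> f (s m) \<le> 1 / real m"
  shows "(\<integral>\<^sup>+ t. indicator {0..} t * ennreal (f t powr a) \<partial>lborel)
    \<le> 8 * (\<Sum>m. ennreal (wt a m * s m))"
proof -
  have "indicator {0..} t * ennreal (f t powr a)
      \<le> 8 * (\<Sum>m. ennreal (wt a m) * indicator {0..<s m} t)" for t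
  proof (cases "0 \<le> t \<and> f t \<noteq> 0")
    case True
    then have ft: "0 < f t" using f(1)[of t] by simp
    \<comment> \<open>\<open>N\<close> lies strictly above \<open>1 / f t\<close>, so that m \<ge> N
      contradicts \<open>f t \<le> 1 / real m\<close>, but not above \<open>2 / f t\<close>, because
      \<open>f t\<close> is at most 1. Hence \<open>f t powr a\<close> is at most twice
      \<open>real N powr (- a)\<close>.\<close>
    define N where "N = nat \<lfloor>1 / f t\<rfloor> + 1"
    have N: "1 / f t < real N" unfolding N_def using ft by (simp add: of_nat_nat) linarith
    have N1: "1 \<le> N" by (simp add: N_def)
    have "real N \<le> 1 / f t + 1" unfolding N_def using ft by (simp add: of_nat_nat)
    moreover have "1 \<le> 1 / f t" using ft f(2)[of t] by simp
    ultimately have N2: "real N \<le> 2 / f t" by (simp add: field_simps)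
    have less: "t < s m" if "N \<le> m" for m
    proof (rule ccontr)
      assume "\<not> t < s m"
      then have "f t \<le> f (s m)" by (intro anti) simp
      also have "\<dots> \<le> 1 / real m" using that N1 by (intro fs) simp
      also have "\<dots> \<le> 1 / real N" using that N1 by (intro divide_left_mono) auto
      also have "\<dots> < f t" using N ft N1 by (simp add: field_simps)
      finally show False by simp
    qed
    have "f t powr a \<le> (2 / real N) powr a"
      using N2 N1 ft a by (intro powr_mono2) (auto simp: field_simps)
    also have "\<dots> = 2 powr a * real N powr (- a)"
      by (simp add: powr_divide powr_minus_divide)
    also have "\<dots> \<le> 2 * real N powr (- a)"
      using a powr_mono[of a 1 "2::real"] by (intro mult_right_mono) auto
    finally have "ennreal (f t powr a) \<le> ennreal (2 * real N powr (- a))" by (rule ennreal_leI)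
    also have "\<dots> = 2 * ennreal (real N powr (- a))" by (simp add: ennreal_mult)
    also have "ennreal (real N powr (- a)) \<le> 4 * (\<Sum>m. ennreal (wt a m) * indicator {0..<s m} t)"
      using a N1 True less by (intro wt_block_suminf) (auto simp: indicator_def)
    finally have "ennreal (f t powr a) \<le> 2 * (4 * (\<Sum>m. ennreal (wt a m) * indicator {0..<s m} t))"
      by (simp add: mult_left_mono)
    also have "\<dots> = 8 * (\<Sum>m. ennreal (wt a m) * indicator {0..<s m} t)"
      by (simp flip: mult.assoc)
    finally show ?thesis using True by simp
  qed (auto simp: indicator_def)
  then have "(\<integral>\<^sup>+ t. indicator {0..} t * ennreal (f t powr a) \<partial>lborel)
      \<le> (\<integral>\<^sup>+ t. 8 * (\<Sum>m. ennreal (wt a m) * indicator {0..<s m} t) \<partial>lborel)"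
    by (intro nn_integral_mono)
  also have "\<dots> = 8 * (\<Sum>m. \<integral>\<^sup>+ t. ennreal (wt a m) * indicator {0..<s m} t \<partial>lborel)"
    by (simp add: nn_integral_cmult nn_integral_suminf)
  also have "(\<lambda>m. \<integral>\<^sup>+ t. ennreal (wt a m) * indicator {0..<s m} t \<partial>lborel) = (\<lambda>m. ennreal (wt a m * s m))"
    using s by (simp add: nn_integral_cmult nn_integral_indicator_Ico ennreal_mult fun_eq_iff)
  finally show ?thesis .
qed

text \<open>After exchanging sum and integral, fix t. A nonzero term with m \<ge> 1 has
  \<open>s m \<le> t\<close>, whence \<open>f t \<le> 1 / real m\<close>, so only m up to 1/f(t)
  contribute. As \<open>wt a m * real m\<close> is m^(-a), these add up to at most
  (1/f(t))^(1-a)/(1-a), and multiplication by f(t) leaves f(t)^a/(1-a).\<close>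

lemma suminf_wt_tail_le:
  fixes f :: "real \<Rightarrow> real"
  assumes a: "0 < a" "a < 1" and [measurable]: "f \<in> borel_measurable borel"
    and anti: "\<And>x y. x \<le> y \<Longrightarrow> f y \<le> f x" and f: "\<And>x. 0 \<le> f x"
    and s: "\<And>m. 0 \<le> s m" and fs: "\<And>m. 1 \<le> m \<Longrightarrow> f (s m) \<le> 1 / real m"
  shows "(\<Sum>m. ennreal (wt a m * real m) * (\<integral>\<^sup>+ t. indicator {s m..} t * ennreal (f t) \<partial>lborel))
    \<le> ennreal (1 / (1 - a)) * (\<integral>\<^sup>+ t. indicator {0..} t * ennreal (f t powr a) \<partial>lborel)"
proof -
  have pt: "(\<Sum>m. ennreal (wt a m * real m) * (indicator {s m..} t * ennreal (f t)))
      \<le> ennreal (1 / (1 - a)) * (indicator {0..} t * ennreal (f t powr a))" for t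
  proof (cases "0 \<le> t \<and> f t \<noteq> 0")
    case True
    then have ft: "0 < f t" using f[of t] by simp
    define N where "N = nat \<lfloor>1 / f t\<rfloor>"
    have N: "real N \<le> 1 / f t" unfolding N_def using ft by (simp add: of_nat_nat)
    have le: "m \<le> N" if "s m \<le> t" "1 \<le> m" for m
    proof -
      have "f t \<le> 1 / real m" using anti[OF that(1)] fs[OF that(2)] by simp
      then have "real m \<le> 1 / f t" using ft that by (simp add: field_simps)
      then show ?thesis unfolding N_def by (simp add: le_nat_floor)
    qed
    have w: "wt a m * real m = real m powr (- a)" for m
      using powr_add[of "real m" 1 "-1-a"] by (cases "m = 0") (auto simp: wt_def mult.commute)
    have "(\<Sum>m. ennreal (wt a m * real m) * (indicator {s m..} t * ennreal (f t)))
        = (\<Sum>m\<in>{1..N}. ennreal (wt a m * real m) * (indicator {s m..} t * ennreal (f t)))"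
    proof (rule suminf_finite)
      fix m assume "m \<notin> {1..N}"
      then have "m = 0 \<or> \<not> s m \<le> t" using le[of m] by force
      then show "ennreal (wt a m * real m) * (indicator {s m..} t * ennreal (f t)) = 0"
        by auto
    qed simp
    also have "\<dots> \<le> (\<Sum>m\<in>{1..N}. ennreal (real m powr (- a) * f t))"
      by (intro sum_mono) (auto simp: w indicator_def ennreal_mult f)
    also have "\<dots> = ennreal ((\<Sum>m=1..N. real m powr (- a)) * f t)"
      using f by (simp add: sum_ennreal sum_distrib_right)
    also have "\<dots> \<le> ennreal ((real N powr (1 - a) / (1 - a)) * f t)"
      using a f by (intro ennreal_leI mult_right_mono sum_powr_minus_le) auto
    also have "\<dots> \<le> ennreal (((1 / f t) powr (1 - a) / (1 - a)) * f t)"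
      using a f N by (intro ennreal_leI mult_right_mono divide_right_mono powr_mono2) auto
    also have "(1 / f t) powr (1 - a) / (1 - a) * f t = 1 / (1 - a) * f t powr a"
      using ft powr_diff[of "f t" 1 "1 - a"] by (simp add: powr_divide)
    finally have "(\<Sum>m. ennreal (wt a m * real m) * (indicator {s m..} t * ennreal (f t)))
        \<le> ennreal (1 / (1 - a) * f t powr a)" .
    also have "\<dots> = ennreal (1 / (1 - a)) * ennreal (f t powr a)"
      using a by (intro ennreal_mult) auto
    finally show ?thesis using True by simp
  next
    case False
    have "ennreal (wt a m * real m) * (indicator {s m..} t * ennreal (f t)) = 0" for m
      using False s[of m] by (auto simp: indicator_def)
    then show ?thesis by (simp only: suminf_zero zero_le)
  qed
  have "(\<Sum>m. ennreal (wt a m * real m) * (\<integral>\<^sup>+ t. indicator {s m..} t * ennreal (f t) \<partial>lborel))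
     = (\<integral>\<^sup>+ t. (\<Sum>m. ennreal (wt a m * real m) * (indicator {s m..} t * ennreal (f t))) \<partial>lborel)"
    by (simp add: nn_integral_cmult nn_integral_suminf)
  also have "\<dots> \<le> (\<integral>\<^sup>+ t. ennreal (1 / (1 - a)) * (indicator {0..} t * ennreal (f t powr a)) \<partial>lborel)"
    by (intro nn_integral_mono pt)
  finally show ?thesis by (simp add: nn_integral_cmult)
qed

text \<open>By monotonicity the block from n to 2n of the convergent series is at least
  \<open>x n\<close> times the weights in it, hence at least a quarter of the quantity in question;
  blocks of a convergent series tend to 0.\<close>

lemma mono_wt_suminf_tendsto_0:
  fixes x :: "nat \<Rightarrow> real"
  assumes a: "0 \<le> a" "a \<le> 1" and x: "\<And>n. 0 \<le> x n" "mono x"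
    and fin: "(\<Sum>n. ennreal (wt a n * x n)) < \<infinity>"
  shows "(\<lambda>n. x n * real n powr (- a)) \<longlonglongrightarrow> 0"
proof -
  have sm: "summable (\<lambda>n. wt a n * x n)"
    using fin x by (intro summable_suminf_not_top) auto
  let ?S = "\<lambda>n. \<Sum>k<n. wt a k * x k"
  have lim: "?S \<longlonglongrightarrow> suminf (\<lambda>n. wt a n * x n)"
    using sm by (rule summable_LIMSEQ)
  have "(\<lambda>n. ?S (n + n)) \<longlonglongrightarrow> suminf (\<lambda>n. wt a n * x n)"
    using LIMSEQ_subseq_LIMSEQ[OF lim, of "\<lambda>n. n + n"] by (simp add: strict_mono_def o_def)
  then have "(\<lambda>n. 4 * (?S (n + n) - ?S n)) \<longlonglongrightarrow> 4 * (suminf (\<lambda>n. wt a n * x n) - suminf (\<lambda>n. wt a n * x n))"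
    by (intro tendsto_intros lim)
  then have lim0: "(\<lambda>n. 4 * (?S (n + n) - ?S n)) \<longlonglongrightarrow> 0" by simp
  show ?thesis
  proof (rule tendsto_sandwich[OF _ _ tendsto_const lim0])
    show "\<forall>\<^sub>F n in sequentially. x n * real n powr (- a) \<le> 4 * (?S (n + n) - ?S n)"
      using eventually_ge_at_top[of 1]
    proof eventually_elim
      case (elim n)
      have "x n * (real n powr (- a) / 4) \<le> x n * (\<Sum>k=n..<2*n. wt a k)"
        using x a elim by (intro mult_left_mono wt_block_sum) auto
      also have "\<dots> = (\<Sum>k=n..<2*n. wt a k * x n)" by (simp add: sum_distrib_left mult.commute)
      also have "\<dots> \<le> (\<Sum>k=n..<2*n. wt a k * x k)"
        using x by (intro sum_mono mult_left_mono) (auto dest: monoD)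
      also have "\<dots> = ?S (n + n) - ?S n"
        using sum_diff_nat_ivl[of 0 n "2*n" "\<lambda>k. wt a k * x k"]
        by (simp add: lessThan_atLeast0 mult_2)
      finally show ?case by simp
    qed
  qed (use x in auto)
qed

section \<open>Maximal inequalities for i.i.d. sequences\<close>

text \<open>Fubini applied to the indicator of s \<le> t < u. As \<open>ennreal\<close> sends
  negative reals to 0, the left side is the mean excess of \<open>u\<close> over \<open>s\<close>,
  with no sign condition on either.\<close>

lemma (in prob_space) nn_integral_layer_cake:
  fixes u :: "'a \<Rightarrow> real"
  assumes [measurable]: "u \<in> borel_measurable M"
  shows "(\<integral>\<^sup>+ \<omega>. ennreal (u \<omega> - s) \<partial>M)
    = (\<integral>\<^sup>+ t. indicator {s..} t * ennreal (prob {\<omega> \<in> space M. t < u \<omega>}) \<partial>lborel)"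
proof -
  interpret P: pair_sigma_finite lborel M ..
  have "(\<integral>\<^sup>+ \<omega>. ennreal (u \<omega> - s) \<partial>M) = (\<integral>\<^sup>+ \<omega>. (\<integral>\<^sup>+ t. indicator {s..<u \<omega>} t \<partial>lborel) \<partial>M)"
    by (simp only: nn_integral_indicator_Ico)
  also have "\<dots> = (\<integral>\<^sup>+ \<omega>. (\<integral>\<^sup>+ t. (if s \<le> t \<and> t < u \<omega> then 1 else 0) \<partial>lborel) \<partial>M)"
    by (intro nn_integral_cong) (auto simp: indicator_def)
  also have "\<dots> = (\<integral>\<^sup>+ t. (\<integral>\<^sup>+ \<omega>. (if s \<le> t \<and> t < u \<omega> then 1 else 0) \<partial>M) \<partial>lborel)"
    by (rule P.Fubini') measurable
  also have "\<dots> = (\<integral>\<^sup>+ t. indicator {s..} t * ennreal (prob {\<omega> \<in> space M. t < u \<omega>}) \<partial>lborel)"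
  proof (intro nn_integral_cong)
    fix t
    have "(\<integral>\<^sup>+ \<omega>. (if s \<le> t \<and> t < u \<omega> then 1 else 0) \<partial>M)
        = (\<integral>\<^sup>+ \<omega>. indicator {s..} t * indicator {\<omega> \<in> space M. t < u \<omega>} \<omega> \<partial>M)"
      by (intro nn_integral_cong) (auto simp: indicator_def)
    also have "\<dots> = indicator {s..} t * emeasure M {\<omega> \<in> space M. t < u \<omega>}"
      by (subst nn_integral_cmult) auto
    finally show "(\<integral>\<^sup>+ \<omega>. (if s \<le> t \<and> t < u \<omega> then 1 else 0) \<partial>M)
        = indicator {s..} t * ennreal (prob {\<omega> \<in> space M. t < u \<omega>})"
      by (simp add: emeasure_eq_measure)
  qed
  finally show ?thesis .
qed

text \<open>Markov's inequality at a multiple of the mean. The strict event keeps it true when the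
  mean is 0: then \<open>u\<close> vanishes almost surely. That case is separate because the
  quotient in Markov's bound degenerates.\<close>

lemma (in prob_space) prob_gt_enn2real_Markov:
  fixes u :: "'a \<Rightarrow> real"
  assumes [measurable]: "u \<in> borel_measurable M" and u: "\<And>\<omega>. 0 \<le> u \<omega>" and c: "0 < c"
    and fin: "(\<integral>\<^sup>+ \<omega>. ennreal (u \<omega>) \<partial>M) < \<infinity>"
  shows "prob {\<omega> \<in> space M. c * enn2real (\<integral>\<^sup>+ \<omega>. ennreal (u \<omega>) \<partial>M) < u \<omega>} \<le> 1 / c"
proof -
  have int: "integrable M u"
    using fin u by (intro integrableI_bounded) auto
  have eq: "enn2real (\<integral>\<^sup>+ \<omega>. ennreal (u \<omega>) \<partial>M) = expectation u"
    using u by (simp add: integral_eq_nn_integral)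
  show ?thesis
  proof (cases "expectation u = 0")
    case True
    then have "AE \<omega> in M. u \<omega> = 0"
      using int u by (subst (asm) integral_nonneg_eq_0_iff_AE) auto
    then have "AE \<omega> in M. \<not> c * expectation u < u \<omega>"
      using True by auto
    then have "prob {\<omega> \<in> space M. c * expectation u < u \<omega>} = 0"
      by (subst prob_eq_0) auto
    then show ?thesis using c eq by simp
  next
    case False
    moreover have "0 \<le> expectation u" using u by simp
    ultimately have pos: "0 < expectation u" by simp
    have "prob {\<omega> \<in> space M. c * expectation u < u \<omega>} \<le> prob {\<omega> \<in> space M. c * expectation u \<le> u \<omega>}"
      by (intro finite_measure_mono) auto
    also have "\<dots> \<le> expectation u / (c * expectation u)"
      using int u pos c by (intro integral_Markov_inequality_measure[where A="{}"]) auto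
    finally show ?thesis using pos c eq by simp
  qed
qed

section \<open>Laws of blocks and increments of an i.i.d. sequence\<close>

locale iid_sequence = prob_space M for M :: "'a measure" +
  fixes Xs :: "nat \<Rightarrow> 'a \<Rightarrow> 'b::{banach, second_countable_topology}"
  assumes rv [measurable]: "\<And>i. Xs i \<in> borel_measurable M"
    and indep: "indep_vars (\<lambda>_. borel) Xs UNIV"
    and ident: "\<And>i. distr M borel (Xs i) = distr M borel (Xs 0)"
begin

lemma measurable_psum [measurable]: "psum Xs n \<in> borel_measurable M"
  unfolding psum_def[abs_def] by measurable

lemma psum_diff: "j \<le> i \<Longrightarrow> psum Xs i \<omega> - psum Xs j \<omega> = (\<Sum>k=j..<i. Xs k \<omega>)"
  using sum_diff_nat_ivl[of 0 j i "\<lambda>k. Xs k \<omega>"] by (simp add: psum_def lessThan_atLeast0)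

text \<open>Both sums are images, under the same map, of the same finite product of the common law.
  The empty block is split off because the product description of independence is applied to a
  nonempty index set.\<close>

lemma distr_block_sum: "distr M borel (\<lambda>\<omega>. \<Sum>k<j. Xs (n + k) \<omega>) = distr M borel (psum Xs j)"
proof (cases "j = 0")
  case True
  then show ?thesis by (simp add: psum_def[abs_def])
next
  case False
  have *: "distr M borel (\<lambda>\<omega>. \<Sum>k<j. Xs (n + k) \<omega>)
      = distr (PiM {..<j} (\<lambda>_. distr M borel (Xs 0))) borel (\<lambda>g. \<Sum>k<j. g k)" for n
  proof -
    \<comment> \<open>Reindexing by n + k: independence is restricted to the singleton blocks
      \<open>{n + k}\<close>, whose only coordinate is then read off.\<close>
    have "indep_vars (\<lambda>k. PiM {n + k} (\<lambda>_. borel)) (\<lambda>k \<omega>. \<lambda>i\<in>{n + k}. Xs i \<omega>) {..<j}"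
      by (rule indep_vars_restrict[OF indep]) (auto simp: disjoint_family_on_def)
    from indep_vars_compose2[OF this, of "\<lambda>k g. g (n + k)" "\<lambda>_. borel"]
    have "indep_vars (\<lambda>_. borel) (\<lambda>k. Xs (n + k)) {..<j}"
      by simp
    then have "distr M (PiM {..<j} (\<lambda>_. borel)) (\<lambda>\<omega>. \<lambda>k\<in>{..<j}. Xs (n + k) \<omega>)
        = PiM {..<j} (\<lambda>k. distr M borel (Xs (n + k)))"
      using False by (subst (asm) indep_vars_iff_distr_eq_PiM) auto
    also have "\<dots> = PiM {..<j} (\<lambda>_. distr M borel (Xs 0))"
      by (intro PiM_cong ident) auto
    finally have PiM: "distr M (PiM {..<j} (\<lambda>_. borel)) (\<lambda>\<omega>. \<lambda>k\<in>{..<j}. Xs (n + k) \<omega>)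
        = PiM {..<j} (\<lambda>_. distr M borel (Xs 0))" .
    have "distr M borel (\<lambda>\<omega>. \<Sum>k<j. Xs (n + k) \<omega>)
        = distr (distr M (PiM {..<j} (\<lambda>_. borel)) (\<lambda>\<omega>. \<lambda>k\<in>{..<j}. Xs (n + k) \<omega>)) borel (\<lambda>g. \<Sum>k<j. g k)"
      by (subst distr_distr) (auto simp: o_def intro!: distr_cong)
    then show ?thesis by (simp only: PiM)
  qed
  show ?thesis using *[of n] *[of 0] by (simp add: psum_def[abs_def])
qed

text \<open>Stationarity of the increments. It turns tail bounds for the sums at n and n + j into
  one for the sum at j, and it lets the increment after a first passage be treated as a fresh
  partial sum.\<close>

lemma prob_psum_diff:
  "prob {\<omega> \<in> space M. r < norm (psum Xs (n + j) \<omega> - psum Xs n \<omega>)} = prob {\<omega> \<in> space M. r < norm (psum Xs j \<omega>)}"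
proof -
  have eq: "psum Xs (n + j) \<omega> - psum Xs n \<omega> = (\<Sum>k<j. Xs (n + k) \<omega>)" for \<omega>
    using psum_diff[of n "n + j"] sum.shift_bounds_nat_ivl[of "\<lambda>k. Xs k \<omega>" 0 n j]
    by (simp add: lessThan_atLeast0 add.commute)
  have "prob {\<omega> \<in> space M. r < norm (Y \<omega>)} = measure (distr M borel Y) {x. r < norm x}"
    if [measurable]: "Y \<in> borel_measurable M" for Y :: "'a \<Rightarrow> 'b"
    by (subst measure_distr) (auto intro!: arg_cong[where f=prob])
  from this[of "\<lambda>\<omega>. \<Sum>k<j. Xs (n + k) \<omega>"] this[of "psum Xs j"] show ?thesis
    by (simp add: eq distr_block_sum)
qed

lemma prob_norm_ident:
  "prob {\<omega> \<in> space M. r < norm (Xs k \<omega>)} = prob {\<omega> \<in> space M. r < norm (Xs 0 \<omega>)}"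
  using prob_psum_diff[of r k 1] by (simp add: psum_def)

section \<open>Decomposition at the first passage over a level\<close>

lemma first_passage:
  assumes "t < norm (psum Xs j \<omega>)"
  shows "\<exists>l\<le>j. t < norm (psum Xs l \<omega>) \<and> (\<forall>i<l. norm (psum Xs i \<omega>) \<le> t)"
proof (intro exI conjI allI impI)
  let ?l = "LEAST j. t < norm (psum Xs j \<omega>)"
  show "?l \<le> j" using assms by (rule Least_le)
  show "t < norm (psum Xs ?l \<omega>)" using assms by (rule LeastI)
  show "norm (psum Xs i \<omega>) \<le> t" if "i < ?l" for i
    using not_less_Least[OF that] by simp
qed

text \<open>The first passages at different times are disjoint events. A passage at time j depends
  only on the variables before j, while \<open>D j\<close> sees only those from j on, so the two are
  independent and the factor \<open>c\<close> comes out of the sum. Passing the restricted future to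
  \<open>D j\<close> makes this separation part of the statement; both maximal inequalities below
  are instances.\<close>

lemma prob_first_passage_le:
  fixes D :: "nat \<Rightarrow> (nat \<Rightarrow> 'b) \<Rightarrow> bool"
  assumes [measurable]: "\<And>j. Measurable.pred (PiM {j..<m} (\<lambda>_. borel)) (D j)"
    and le: "\<And>j. j \<le> m \<Longrightarrow> prob {\<omega> \<in> space M. D j (\<lambda>k\<in>{j..<m}. Xs k \<omega>)} \<le> c"
  shows "prob {\<omega> \<in> space M. \<exists>j\<le>m. t < norm (psum Xs j \<omega>) \<and> (\<forall>i<j. norm (psum Xs i \<omega>) \<le> t)
      \<and> D j (\<lambda>k\<in>{j..<m}. Xs k \<omega>)} \<le> c * prob {\<omega> \<in> space M. \<exists>j\<le>m. t < norm (psum Xs j \<omega>)}"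
proof -
  define A where "A j = {\<omega> \<in> space M. t < norm (psum Xs j \<omega>) \<and> (\<forall>i<j. norm (psum Xs i \<omega>) \<le> t)}" for j
  define B where "B j = {\<omega> \<in> space M. D j (\<lambda>k\<in>{j..<m}. Xs k \<omega>)}" for j
  have [measurable]: "A j \<in> events" for j unfolding A_def by measurable
  have [measurable]: "B j \<in> events" for j
  proof -
    have "(\<lambda>\<omega>. \<lambda>k\<in>{j..<m}. Xs k \<omega>) \<in> measurable M (PiM {j..<m} (\<lambda>_. borel))" by measurable
    then have "Measurable.pred M (\<lambda>\<omega>. D j (\<lambda>k\<in>{j..<m}. Xs k \<omega>))" by measurable
    then show ?thesis unfolding B_def by measurable
  qed
  have disj: "disjoint_family_on A {..m}"
    unfolding disjoint_family_on_def A_def by (auto simp: not_le) (metis linorder_neqE_nat not_le)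
  have AB: "prob (A j \<inter> B j) = prob (A j) * prob (B j)" for j
  proof -
    define A' where "A' = {g \<in> space (PiM {..<j} (\<lambda>_. borel :: 'b measure)). t < norm (\<Sum>k<j. g k) \<and> (\<forall>i<j. norm (\<Sum>k<i. g k) \<le> t)}"
    define B' where "B' = {g \<in> space (PiM {j..<m} (\<lambda>_. borel :: 'b measure)). D j g}"
    have m1: "A' \<in> sets (PiM {..<j} (\<lambda>_. borel))"
    proof -
      have [measurable]: "(\<lambda>g. \<Sum>k<i. g k) \<in> borel_measurable (PiM {..<j} (\<lambda>_. borel :: 'b measure))" if "i \<le> j" for i
        using that by (intro borel_measurable_sum measurable_component_singleton) auto
      have "A' = {g \<in> space (PiM {..<j} (\<lambda>_. borel :: 'b measure)). t < norm (\<Sum>k<j. g k)} \<inter>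
         {g \<in> space (PiM {..<j} (\<lambda>_. borel :: 'b measure)). \<forall>i\<in>{..<j}. norm (\<Sum>k<i. g k) \<le> t}"
        by (auto simp: A'_def)
      also have "\<dots> \<in> sets (PiM {..<j} (\<lambda>_. borel))"
        by (intro sets.Int sets.sets_Collect_finite_All) (auto intro!: borel_measurable_le borel_measurable_less borel_measurable_norm)
      finally show ?thesis .
    qed
    have m2: "B' \<in> sets (PiM {j..<m} (\<lambda>_. borel))"
      unfolding B'_def by measurable
    have "indep_var (PiM {..<j} (\<lambda>_. borel)) (\<lambda>\<omega>. \<lambda>k\<in>{..<j}. Xs k \<omega>) (PiM {j..<m} (\<lambda>_. borel)) (\<lambda>\<omega>. \<lambda>k\<in>{j..<m}. Xs k \<omega>)"
      by (rule indep_var_restrict[OF indep]) auto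
    note ind = indep_varD[OF this m1 m2]
    have A: "(\<lambda>\<omega>. \<lambda>k\<in>{..<j}. Xs k \<omega>) -` A' \<inter> space M = A j"
      by (auto simp: A'_def A_def space_PiM psum_def)
    have B: "(\<lambda>\<omega>. \<lambda>k\<in>{j..<m}. Xs k \<omega>) -` B' \<inter> space M = B j"
      by (auto simp: B'_def B_def space_PiM)
    have "(\<lambda>\<omega>. (\<lambda>k\<in>{..<j}. Xs k \<omega>, \<lambda>k\<in>{j..<m}. Xs k \<omega>)) -` (A' \<times> B') \<inter> space M
      = ((\<lambda>\<omega>. \<lambda>k\<in>{..<j}. Xs k \<omega>) -` A' \<inter> space M) \<inter> ((\<lambda>\<omega>. \<lambda>k\<in>{j..<m}. Xs k \<omega>) -` B' \<inter> space M)"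
      by auto
    with ind show ?thesis by (simp only: A B)
  qed
  have "prob {\<omega> \<in> space M. \<exists>j\<le>m. t < norm (psum Xs j \<omega>) \<and> (\<forall>i<j. norm (psum Xs i \<omega>) \<le> t)
      \<and> D j (\<lambda>k\<in>{j..<m}. Xs k \<omega>)} = prob (\<Union>j\<in>{..m}. A j \<inter> B j)"
    by (rule arg_cong[where f=prob]) (auto simp: A_def B_def)
  also have "\<dots> \<le> (\<Sum>j\<in>{..m}. prob (A j \<inter> B j))"
    by (intro finite_measure_subadditive_finite) auto
  also have "\<dots> \<le> (\<Sum>j\<in>{..m}. c * prob (A j))"
    unfolding AB mult.commute[of c] using le by (intro sum_mono mult_left_mono) (auto simp: B_def)
  also have "\<dots> = c * prob (\<Union>j\<in>{..m}. A j)"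
    using disj by (subst finite_measure_finite_Union) (auto simp: sum_distrib_left)
  also have "(\<Union>j\<in>{..m}. A j) = {\<omega> \<in> space M. \<exists>j\<le>m. t < norm (psum Xs j \<omega>)}"
  proof (intro equalityI subsetI)
    fix \<omega> assume "\<omega> \<in> {\<omega> \<in> space M. \<exists>j\<le>m. t < norm (psum Xs j \<omega>)}"
    then obtain j where j: "\<omega> \<in> space M" "j \<le> m" "t < norm (psum Xs j \<omega>)" by auto
    obtain l where "l \<le> j" "t < norm (psum Xs l \<omega>)" "\<forall>i<l. norm (psum Xs i \<omega>) \<le> t"
      using first_passage[OF j(3)] by blast
    with j have "\<omega> \<in> A l" "l \<in> {..m}" by (auto simp: A_def)
    then show "\<omega> \<in> (\<Union>j\<in>{..m}. A j)" by blast
  qed (auto simp: A_def)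
  finally show ?thesis .
qed

section \<open>Running maxima of the norms of the partial sums\<close>

definition rmax :: "nat \<Rightarrow> 'a \<Rightarrow> real" where
  "rmax m \<omega> = Max ((\<lambda>j. norm (psum Xs j \<omega>)) ` {..m})"

lemma measurable_rmax [measurable]: "rmax m \<in> borel_measurable M"
  unfolding rmax_def[abs_def] by (intro borel_measurable_Max) auto

lemma less_rmax_iff: "t < rmax m \<omega> \<longleftrightarrow> (\<exists>j\<le>m. t < norm (psum Xs j \<omega>))"
  unfolding rmax_def by (subst Max_gr_iff) auto

lemma norm_psum_le_rmax: "j \<le> m \<Longrightarrow> norm (psum Xs j \<omega>) \<le> rmax m \<omega>"
  unfolding rmax_def by (intro Max_ge) auto

lemma rmax_nonneg: "0 \<le> rmax m \<omega>"
  using norm_psum_le_rmax[of 0 m \<omega>] by (simp add: psum_def)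

lemma mono_rmax: "mono (\<lambda>m. rmax m \<omega>)"
  unfolding rmax_def by (intro monoI Max_mono) auto

text \<open>A crude bound, used only to make the expected maximum finite before absorption.\<close>

lemma rmax_le_sum: "rmax m \<omega> \<le> (\<Sum>k<m. norm (Xs k \<omega>))"
proof -
  have "norm (psum Xs j \<omega>) \<le> (\<Sum>k<m. norm (Xs k \<omega>))" if "j \<le> m" for j
    unfolding psum_def using that
    by (intro order.trans[OF norm_sum] sum_mono2) auto
  then show ?thesis unfolding rmax_def by (intro Max.boundedI) auto
qed

text \<open>If the sums first exceed 2r at time l, then either the sum at m still exceeds r, or the
  increment from l to m does. The first event has probability at most \<open>c\<close>; the
  increment is independent of the passage and distributed as a partial sum, so the second costs at
  most another \<open>c\<close>.\<close>

lemma Ottaviani: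
  assumes "\<And>j. j \<le> m \<Longrightarrow> prob {\<omega> \<in> space M. r < norm (psum Xs j \<omega>)} \<le> c"
  shows "prob {\<omega> \<in> space M. 2 * r < rmax m \<omega>} \<le> 2 * c"
proof -
  define D where "D j g \<longleftrightarrow> r < norm (\<Sum>k=j..<m. g k :: 'b)" for j g
  let ?E = "{\<omega> \<in> space M. \<exists>j\<le>m. 2 * r < norm (psum Xs j \<omega>) \<and> (\<forall>i<j. norm (psum Xs i \<omega>) \<le> 2 * r)
      \<and> D j (\<lambda>k\<in>{j..<m}. Xs k \<omega>)}"
  have c: "0 \<le> c" using assms[of 0] measure_nonneg order.trans by blast
  have D_eq: "D j (\<lambda>k\<in>{j..<m}. Xs k \<omega>) \<longleftrightarrow> r < norm (psum Xs m \<omega> - psum Xs j \<omega>)" if "j \<le> m" for j \<omega>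
    using that by (simp add: D_def psum_diff)
  have [measurable]: "Measurable.pred (PiM {j..<m} (\<lambda>_. borel)) (D j)" for j
    unfolding D_def by measurable
  have "prob ?E \<le> c * prob {\<omega> \<in> space M. \<exists>j\<le>m. 2 * r < norm (psum Xs j \<omega>)}"
  proof (rule prob_first_passage_le)
    fix j assume "j \<le> m"
    then show "prob {\<omega> \<in> space M. D j (\<lambda>k\<in>{j..<m}. Xs k \<omega>)} \<le> c"
      using prob_psum_diff[of r j "m - j"] assms[of "m - j"] by (simp add: D_eq)
  qed simp
  also have "\<dots> \<le> c * 1" using c by (intro mult_left_mono) auto
  finally have E: "prob ?E \<le> c" by simp
  have [measurable]: "?E \<in> events"
  proof -
    have "?E = {\<omega> \<in> space M. \<exists>j\<in>{..m}. 2 * r < norm (psum Xs j \<omega>) \<and> (\<forall>i<j. norm (psum Xs i \<omega>) \<le> 2 * r)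
      \<and> r < norm (psum Xs m \<omega> - psum Xs j \<omega>)}"
      by (auto simp: D_eq)
    also have "\<dots> \<in> events" by measurable
    finally show ?thesis .
  qed
  have "{\<omega> \<in> space M. 2 * r < rmax m \<omega>} \<subseteq> {\<omega> \<in> space M. r < norm (psum Xs m \<omega>)} \<union> ?E"
  proof
    fix \<omega> assume "\<omega> \<in> {\<omega> \<in> space M. 2 * r < rmax m \<omega>}"
    then obtain j where j: "\<omega> \<in> space M" "j \<le> m" "2 * r < norm (psum Xs j \<omega>)"
      by (auto simp: less_rmax_iff)
    obtain l where lj: "l \<le> j" and l: "2 * r < norm (psum Xs l \<omega>)"
      and less: "\<forall>i<l. norm (psum Xs i \<omega>) \<le> 2 * r"
      using first_passage[OF j(3)] by blast
    have lm: "l \<le> m" using lj j(2) by simp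
    show "\<omega> \<in> {\<omega> \<in> space M. r < norm (psum Xs m \<omega>)} \<union> ?E"
    proof (cases "r < norm (psum Xs m \<omega>)")
      case False
      then have "r < norm (psum Xs m \<omega> - psum Xs l \<omega>)"
        using l norm_triangle_ineq2[of "psum Xs l \<omega>" "psum Xs m \<omega>"] by (simp add: norm_minus_commute)
      then have "D l (\<lambda>k\<in>{l..<m}. Xs k \<omega>)" using lm by (simp add: D_eq)
      then show ?thesis using j(1) l lm less by blast
    qed (use j in auto)
  qed
  then have "prob {\<omega> \<in> space M. 2 * r < rmax m \<omega>} \<le> prob ({\<omega> \<in> space M. r < norm (psum Xs m \<omega>)} \<union> ?E)"
    by (intro finite_measure_mono) auto
  also have "\<dots> \<le> prob {\<omega> \<in> space M. r < norm (psum Xs m \<omega>)} + prob ?E"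
    by (intro measure_Un_le) auto
  also have "\<dots> \<le> c + c" using assms[of m] E by (intro add_mono) auto
  finally show ?thesis by simp
qed

text \<open>At the first passage over \<open>t\<close> the sum is at most t + N: it was at most
  \<open>t\<close> one step before, and the step is at most \<open>N\<close>. To get beyond t + N +
  4r, a later increment must therefore exceed 4r, and this is independent of the passage. Leaving
  the dominating variable \<open>N\<close> open, instead of taking the largest step, permits a
  choice whose mean is easy to compute.\<close>

lemma Hoffmann_Jorgensen:
  assumes c: "prob {\<omega> \<in> space M. 2 * r < rmax m \<omega>} \<le> c" and t: "0 \<le> t" and r: "0 \<le> r"
    and [measurable]: "N \<in> borel_measurable M" and N: "\<And>k \<omega>. k < m \<Longrightarrow> norm (Xs k \<omega>) \<le> N \<omega>"
    and N0: "\<And>\<omega>. 0 \<le> N \<omega>"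
  shows "prob {\<omega> \<in> space M. t + N \<omega> + 4 * r < rmax m \<omega>} \<le> c * prob {\<omega> \<in> space M. t < rmax m \<omega>}"
proof -
  define D where "D j g \<longleftrightarrow> (\<exists>i\<in>{j..m}. 4 * r < norm (\<Sum>k=j..<i. g k :: 'b))" for j g
  let ?E = "{\<omega> \<in> space M. \<exists>j\<le>m. t < norm (psum Xs j \<omega>) \<and> (\<forall>i<j. norm (psum Xs i \<omega>) \<le> t)
      \<and> D j (\<lambda>k\<in>{j..<m}. Xs k \<omega>)}"
  have D_eq: "D j (\<lambda>k\<in>{j..<m}. Xs k \<omega>) \<longleftrightarrow> (\<exists>i\<in>{j..m}. 4 * r < norm (psum Xs i \<omega> - psum Xs j \<omega>))" for j \<omega>
    unfolding D_def by (intro bex_cong) (simp_all add: psum_diff)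
  have [measurable]: "Measurable.pred (PiM {j..<m} (\<lambda>_. borel)) (D j)" for j
  proof -
    have "(\<lambda>g. \<Sum>k=j..<i. g k) \<in> borel_measurable (PiM {j..<m} (\<lambda>_. borel :: 'b measure))" if "i \<in> {j..m}" for i
      using that by (intro borel_measurable_sum measurable_component_singleton) auto
    then show ?thesis
      unfolding D_def by (intro pred_intros_finite borel_measurable_less borel_measurable_norm) auto
  qed
  have E: "prob ?E \<le> c * prob {\<omega> \<in> space M. \<exists>j\<le>m. t < norm (psum Xs j \<omega>)}"
  proof (rule prob_first_passage_le)
    fix j assume j: "j \<le> m"
    \<comment> \<open>An increment above 4r forces one of its two end sums above 2r, so the
      hypothesis on \<open>rmax m\<close> itself covers the increments after time j.\<close>
    have "{\<omega> \<in> space M. D j (\<lambda>k\<in>{j..<m}. Xs k \<omega>)} \<subseteq> {\<omega> \<in> space M. 2 * r < rmax m \<omega>}"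
    proof
      fix \<omega> assume "\<omega> \<in> {\<omega> \<in> space M. D j (\<lambda>k\<in>{j..<m}. Xs k \<omega>)}"
      then obtain i where i: "\<omega> \<in> space M" "i \<le> m" "4 * r < norm (psum Xs i \<omega> - psum Xs j \<omega>)"
        by (auto simp: D_eq)
      have "norm (psum Xs i \<omega> - psum Xs j \<omega>) \<le> rmax m \<omega> + rmax m \<omega>"
        using norm_triangle_ineq4[of "psum Xs i \<omega>" "psum Xs j \<omega>"]
          norm_psum_le_rmax[OF i(2), of \<omega>] norm_psum_le_rmax[OF j, of \<omega>] by simp
      then show "\<omega> \<in> {\<omega> \<in> space M. 2 * r < rmax m \<omega>}" using i by simp
    qed
    then have "prob {\<omega> \<in> space M. D j (\<lambda>k\<in>{j..<m}. Xs k \<omega>)} \<le> prob {\<omega> \<in> space M. 2 * r < rmax m \<omega>}"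
      by (intro finite_measure_mono) auto
    with c show "prob {\<omega> \<in> space M. D j (\<lambda>k\<in>{j..<m}. Xs k \<omega>)} \<le> c" by simp
  qed simp
  have [measurable]: "?E \<in> events"
  proof -
    have "?E = {\<omega> \<in> space M. \<exists>j\<in>{..m}. t < norm (psum Xs j \<omega>) \<and> (\<forall>i<j. norm (psum Xs i \<omega>) \<le> t)
      \<and> (\<exists>i\<in>{j..m}. 4 * r < norm (psum Xs i \<omega> - psum Xs j \<omega>))}"
      by (auto simp: D_eq)
    also have "\<dots> \<in> events" by measurable
    finally show ?thesis .
  qed
  have "{\<omega> \<in> space M. t + N \<omega> + 4 * r < rmax m \<omega>} \<subseteq> ?E"
  proof
    fix \<omega> assume "\<omega> \<in> {\<omega> \<in> space M. t + N \<omega> + 4 * r < rmax m \<omega>}"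
    then obtain j where j: "\<omega> \<in> space M" "j \<le> m" "t + N \<omega> + 4 * r < norm (psum Xs j \<omega>)"
      by (auto simp: less_rmax_iff)
    have "0 \<le> N \<omega> + 4 * r" using r N0[of \<omega>] by simp
    then have "t < norm (psum Xs j \<omega>)" using j(3) by simp
    then obtain l where lj: "l \<le> j" and l: "t < norm (psum Xs l \<omega>)"
      and less: "\<forall>i<l. norm (psum Xs i \<omega>) \<le> t"
      using first_passage by blast
    have lm: "l \<le> m" using lj j(2) by simp
    have "l \<noteq> 0" using l t by (cases "l = 0") (simp_all add: psum_def)
    then obtain l' where l': "l = Suc l'" using not0_implies_Suc by blast
    have "norm (psum Xs l \<omega>) \<le> norm (psum Xs l' \<omega>) + norm (Xs l' \<omega>)"
      by (simp add: l' psum_def norm_triangle_ineq)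
    also have "\<dots> \<le> t + N \<omega>"
      using less N[of l' \<omega>] lm by (intro add_mono) (auto simp: l')
    finally have "4 * r < norm (psum Xs j \<omega> - psum Xs l \<omega>)"
      using j(3) norm_triangle_ineq2[of "psum Xs j \<omega>" "psum Xs l \<omega>"] by simp
    then have "D l (\<lambda>k\<in>{l..<m}. Xs k \<omega>)"
      using j(2) lj unfolding D_eq by (intro bexI[of _ j]) auto
    then show "\<omega> \<in> ?E" using j(1) lm l less by blast
  qed
  then have "prob {\<omega> \<in> space M. t + N \<omega> + 4 * r < rmax m \<omega>} \<le> prob ?E"
    by (intro finite_measure_mono) auto
  also note E
  finally show ?thesis by (simp only: less_rmax_iff)
qed

lemma nn_integral_norm_ident: "(\<integral>\<^sup>+ \<omega>. ennreal (norm (Xs k \<omega>) - s) \<partial>M) = (\<integral>\<^sup>+ \<omega>. ennreal (norm (Xs 0 \<omega>) - s) \<partial>M)"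
  by (simp add: nn_integral_layer_cake prob_norm_ident[of _ k])

text \<open>Integrating the preceding inequality over t \<ge> 0 bounds the mean excess of the
  maximum over \<open>N + 4 * r\<close> by half the mean of the maximum; this half is absorbed,
  which is legitimate because integrability of \<open>Xs 0\<close> makes the mean finite.\<close>

lemma nn_integral_rmax_le:
  assumes c: "prob {\<omega> \<in> space M. 2 * r < rmax m \<omega>} \<le> 1 / 2" and r: "0 \<le> r"
    and int: "integrable M (Xs 0)"
  shows "(\<integral>\<^sup>+ \<omega>. ennreal (rmax m \<omega>) \<partial>M)
    \<le> 2 * (ennreal (8 * r) + of_nat m * (\<integral>\<^sup>+ \<omega>. ennreal (norm (Xs 0 \<omega>) - 4 * r) \<partial>M))"
proof -
  \<comment> \<open>Replacing the largest step by 4r plus the sum of all excesses over 4r keeps a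
    bound for every step and makes the mean linear in the excess of a single variable. Together with
    the 4r of the inequality this gives the 8r of the claim.\<close>
  define N where "N \<omega> = 4 * r + (\<Sum>k<m. max 0 (norm (Xs k \<omega>) - 4 * r))" for \<omega>
  have [measurable]: "N \<in> borel_measurable M" unfolding N_def[abs_def] by measurable
  have N0: "0 \<le> N \<omega>" for \<omega> unfolding N_def using r by (intro add_nonneg_nonneg sum_nonneg) auto
  have N: "norm (Xs k \<omega>) \<le> N \<omega>" if "k < m" for k \<omega>
  proof -
    have "norm (Xs k \<omega>) - 4 * r \<le> max 0 (norm (Xs k \<omega>) - 4 * r)" by simp
    also have "\<dots> \<le> (\<Sum>k<m. max 0 (norm (Xs k \<omega>) - 4 * r))"
      using that by (intro member_le_sum) auto
    finally show ?thesis by (simp add: N_def)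
  qed
  let ?I = "\<integral>\<^sup>+ \<omega>. ennreal (rmax m \<omega>) \<partial>M"
  let ?Z = "\<integral>\<^sup>+ \<omega>. ennreal (N \<omega> + 4 * r) \<partial>M"
  have fin: "?I < \<infinity>"
  proof -
    have "?I \<le> (\<integral>\<^sup>+ \<omega>. (\<Sum>k<m. ennreal (norm (Xs k \<omega>))) \<partial>M)"
      using rmax_le_sum by (intro nn_integral_mono) (simp add: sum_ennreal ennreal_leI)
    also have "\<dots> = (\<Sum>k<m. \<integral>\<^sup>+ \<omega>. ennreal (norm (Xs k \<omega>)) \<partial>M)"
      by (rule nn_integral_sum) auto
    also have "\<dots> = (\<Sum>k<m. \<integral>\<^sup>+ \<omega>. ennreal (norm (Xs 0 \<omega>)) \<partial>M)"
      using nn_integral_norm_ident[of _ 0] by (intro sum.cong) auto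
    also have "\<dots> < \<infinity>"
      using int by (auto simp: integrable_iff_bounded ennreal_mult_less_top of_nat_less_top)
    finally show ?thesis .
  qed
  have "?I = (\<integral>\<^sup>+ t. indicator {0..} t * ennreal (prob {\<omega> \<in> space M. t < rmax m \<omega>}) \<partial>lborel)"
    using nn_integral_layer_cake[of "rmax m" 0] by simp
  note I = this
  have "(\<integral>\<^sup>+ \<omega>. ennreal (rmax m \<omega> - (N \<omega> + 4 * r) - 0) \<partial>M)
      = (\<integral>\<^sup>+ t. indicator {0..} t * ennreal (prob {\<omega> \<in> space M. t < rmax m \<omega> - (N \<omega> + 4 * r)}) \<partial>lborel)"
    by (rule nn_integral_layer_cake) measurable
  also have "\<dots> \<le> (\<integral>\<^sup>+ t. ennreal (1/2) * (indicator {0..} t * ennreal (prob {\<omega> \<in> space M. t < rmax m \<omega>})) \<partial>lborel)"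
  proof (intro nn_integral_mono)
    fix t :: real
    have "prob {\<omega> \<in> space M. t < rmax m \<omega> - (N \<omega> + 4 * r)} \<le> 1/2 * prob {\<omega> \<in> space M. t < rmax m \<omega>}"
      if "0 \<le> t"
      using Hoffmann_Jorgensen[OF c that r _ N N0] by (simp add: algebra_simps)
    then have "ennreal (prob {\<omega> \<in> space M. t < rmax m \<omega> - (N \<omega> + 4 * r)})
        \<le> ennreal (1/2) * ennreal (prob {\<omega> \<in> space M. t < rmax m \<omega>})" if "0 \<le> t"
      using that by (subst ennreal_mult[symmetric]) (auto intro: ennreal_leI)
    then show "indicator {0..} t * ennreal (prob {\<omega> \<in> space M. t < rmax m \<omega> - (N \<omega> + 4 * r)})
       \<le> ennreal (1/2) * (indicator {0..} t * ennreal (prob {\<omega> \<in> space M. t < rmax m \<omega>}))"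
      by (cases "0 \<le> t") simp_all
  qed
  also have "\<dots> = ennreal (1/2) * ?I"
    unfolding I by (rule nn_integral_cmult) measurable
  finally have half: "(\<integral>\<^sup>+ \<omega>. ennreal (rmax m \<omega> - (N \<omega> + 4 * r)) \<partial>M) \<le> ennreal (1/2) * ?I" by simp
  have "?I \<le> (\<integral>\<^sup>+ \<omega>. ennreal (N \<omega> + 4 * r) + ennreal (rmax m \<omega> - (N \<omega> + 4 * r)) \<partial>M)"
  proof (intro nn_integral_mono)
    fix \<omega>
    have "ennreal (rmax m \<omega>) \<le> ennreal ((N \<omega> + 4 * r) + max 0 (rmax m \<omega> - (N \<omega> + 4 * r)))"
      by (intro ennreal_leI) simp
    also have "\<dots> = ennreal (N \<omega> + 4 * r) + ennreal (max 0 (rmax m \<omega> - (N \<omega> + 4 * r)))"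
      using N0[of \<omega>] r by (intro ennreal_plus) auto
    finally show "ennreal (rmax m \<omega>) \<le> ennreal (N \<omega> + 4 * r) + ennreal (rmax m \<omega> - (N \<omega> + 4 * r))"
      by (simp add: ennreal_max_0)
  qed
  also have "\<dots> = ?Z + (\<integral>\<^sup>+ \<omega>. ennreal (rmax m \<omega> - (N \<omega> + 4 * r)) \<partial>M)"
    by (rule nn_integral_add) measurable
  also have "\<dots> \<le> ?Z + ennreal (1/2) * ?I"
    using half by (intro add_left_mono)
  finally have "?I \<le> ?Z + ennreal (1/2) * ?I" .
  with fin have "?I \<le> 2 * ?Z" by (rule ennreal_le_twice)
  also have "?Z = ennreal (8 * r) + of_nat m * (\<integral>\<^sup>+ \<omega>. ennreal (norm (Xs 0 \<omega>) - 4 * r) \<partial>M)"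
  proof -
    have "ennreal (N \<omega> + 4 * r) = ennreal (8 * r) + (\<Sum>k<m. ennreal (norm (Xs k \<omega>) - 4 * r))" for \<omega>
    proof -
      have "ennreal (N \<omega> + 4 * r) = ennreal (8 * r + (\<Sum>k<m. max 0 (norm (Xs k \<omega>) - 4 * r)))"
        by (simp add: N_def)
      also have "\<dots> = ennreal (8 * r) + ennreal (\<Sum>k<m. max 0 (norm (Xs k \<omega>) - 4 * r))"
        using r by (intro ennreal_plus sum_nonneg) auto
      also have "ennreal (\<Sum>k<m. max 0 (norm (Xs k \<omega>) - 4 * r)) = (\<Sum>k<m. ennreal (max 0 (norm (Xs k \<omega>) - 4 * r)))"
        by (rule sum_ennreal[symmetric]) simp
      finally show ?thesis by (simp add: ennreal_max_0)
    qed
    then have "?Z = (\<integral>\<^sup>+ \<omega>. ennreal (8 * r) + (\<Sum>k<m. ennreal (norm (Xs k \<omega>) - 4 * r)) \<partial>M)"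
      by simp
    also have "\<dots> = (\<integral>\<^sup>+ \<omega>. ennreal (8 * r) \<partial>M) + (\<Sum>k<m. \<integral>\<^sup>+ \<omega>. ennreal (norm (Xs k \<omega>) - 4 * r) \<partial>M)"
      by (simp add: nn_integral_add nn_integral_sum)
    also have "\<dots> = ennreal (8 * r) + of_nat m * (\<integral>\<^sup>+ \<omega>. ennreal (norm (Xs 0 \<omega>) - 4 * r) \<partial>M)"
    proof -
      have "(\<Sum>k<m. \<integral>\<^sup>+ \<omega>. ennreal (norm (Xs k \<omega>) - 4 * r) \<partial>M) = (\<Sum>k<m. \<integral>\<^sup>+ \<omega>. ennreal (norm (Xs 0 \<omega>) - 4 * r) \<partial>M)"
        by (intro sum.cong refl nn_integral_norm_ident)
      then show ?thesis by (simp add: emeasure_space_1)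
    qed
    finally show ?thesis .
  qed
  finally show ?thesis .
qed

text \<open>While the maximum stays below 2r, every step, as a difference of two sums, stays below
  4r. So all m steps do with probability at least 1/2. If one step exceeded 4r with probability f >
  1/m, independence would give (1-f)^m \<le> exp(-mf) < exp(-1) < 1/2.\<close>

lemma prob_norm_gt_le:
  assumes c: "prob {\<omega> \<in> space M. 2 * r < rmax m \<omega>} \<le> 1 / 2" and m: "1 \<le> m"
  shows "prob {\<omega> \<in> space M. 4 * r < norm (Xs 0 \<omega>)} \<le> 1 / real m"
proof (rule ccontr)
  let ?f = "prob {\<omega> \<in> space M. 4 * r < norm (Xs 0 \<omega>)}"
  assume "\<not> ?f \<le> 1 / real m"
  then have f: "1 < real m * ?f" using m by (simp add: field_simps)
  have "1 / 2 \<le> prob {\<omega> \<in> space M. \<not> 2 * r < rmax m \<omega>}"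
    using c by (subst prob_neg) auto
  also have "\<dots> \<le> prob (\<Inter>k\<in>{..<m}. Xs k -` {x. norm x \<le> 4 * r} \<inter> space M)"
  proof (intro finite_measure_mono subsetI)
    fix \<omega> assume \<omega>: "\<omega> \<in> {\<omega> \<in> space M. \<not> 2 * r < rmax m \<omega>}"
    have "norm (Xs k \<omega>) \<le> 4 * r" if "k < m" for k
    proof -
      have "Xs k \<omega> = psum Xs (Suc k) \<omega> - psum Xs k \<omega>" by (simp add: psum_def)
      then have "norm (Xs k \<omega>) \<le> norm (psum Xs (Suc k) \<omega>) + norm (psum Xs k \<omega>)"
        by (simp add: norm_triangle_ineq4)
      also have "\<dots> \<le> rmax m \<omega> + rmax m \<omega>"
        using that by (intro add_mono norm_psum_le_rmax) auto
      finally show ?thesis using \<omega> by simp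
    qed
    then show "\<omega> \<in> (\<Inter>k\<in>{..<m}. Xs k -` {x. norm x \<le> 4 * r} \<inter> space M)"
      using \<omega> m by auto
  next
    show "(\<Inter>k\<in>{..<m}. Xs k -` {x. norm x \<le> 4 * r} \<inter> space M) \<in> events"
      using m by (intro sets.finite_INT measurable_sets[OF rv]) (auto simp: lessThan_empty_iff intro!: borel_closed closed_Collect_le continuous_intros)
  qed
  also have "\<dots> = (\<Prod>k\<in>{..<m}. prob (Xs k -` {x. norm x \<le> 4 * r} \<inter> space M))"
    using m by (intro indep_varsD_finite[OF indep_vars_subset[OF indep]])
      (auto simp: lessThan_empty_iff intro!: borel_closed closed_Collect_le continuous_intros)
  also have "\<dots> = (1 - ?f) ^ m"
  proof -
    have "prob (Xs k -` {x. norm x \<le> 4 * r} \<inter> space M) = 1 - ?f" for k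
    proof -
      have "Xs k -` {x. norm x \<le> 4 * r} \<inter> space M = {\<omega> \<in> space M. \<not> 4 * r < norm (Xs k \<omega>)}" by auto
      then show ?thesis by (simp add: prob_neg prob_norm_ident[of _ k] del: not_less)
    qed
    then show ?thesis by simp
  qed
  also have "\<dots> \<le> exp (- ?f) ^ m"
    using exp_ge_add_one_self[of "- ?f"] by (intro power_mono) auto
  also have "\<dots> = exp (- (real m * ?f))" by (simp add: exp_of_nat_mult[symmetric])
  also have "\<dots> < exp (-1)" using f by simp
  also have "\<dots> \<le> 1 / 2" using exp_ge_add_one_self[of 1] by (simp add: exp_minus field_simps)
  finally show False by simp
qed

subsection \<open>Consequences of almost sure summability\<close>

lemma exists_quantile_sequence:
  assumes fin: "AE \<omega> in M. (\<Sum>n. ennreal (wt a n * norm (psum Xs n \<omega>))) < \<infinity>"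
  shows "\<exists>q. (\<forall>n. 0 \<le> q n) \<and> (\<Sum>n. ennreal (wt a n * q n)) < \<infinity> \<and>
    (\<forall>n. prob {\<omega> \<in> space M. q n < norm (psum Xs n \<omega>)} \<le> 1 / 8)"
proof -
  define V where "V \<omega> = (\<Sum>n. ennreal (wt a n * norm (psum Xs n \<omega>)))" for \<omega>
  have [measurable]: "V \<in> borel_measurable M" unfolding V_def[abs_def] by measurable
  define G where "G K = {\<omega> \<in> space M. V \<omega> \<le> of_nat K}" for K :: nat
  have [measurable]: "G K \<in> events" for K unfolding G_def by measurable
  have "(\<lambda>K. prob (G K)) \<longlonglongrightarrow> prob (\<Union>K. G K)"
  proof (rule finite_Lim_measure_incseq)
    have "(of_nat m :: ennreal) \<le> of_nat n" if "m \<le> n" for m n using that by simp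
    then show "incseq G" unfolding incseq_def G_def by (blast intro: order.trans)
  qed auto
  moreover have "prob (\<Union>K. G K) = 1"
  proof (subst prob_eq_1)
    show "AE \<omega> in M. \<omega> \<in> (\<Union>K. G K)"
      using fin AE_space
    proof eventually_elim
      case (elim \<omega>)
      then have "V \<omega> < top" by (simp add: V_def)
      then obtain K where "V \<omega> < of_nat K" using ennreal_Ex_less_of_nat by blast
      then show ?case using elim by (auto simp: G_def intro!: exI[of _ K] less_imp_le)
    qed
  qed auto
  ultimately have "(\<lambda>K. prob (G K)) \<longlonglongrightarrow> 1" by simp
  then have "\<forall>\<^sub>F K in sequentially. 15 / 16 < prob (G K)"
    by (rule order_tendstoD) simp
  then obtain K where K: "15 / 16 < prob (G K)" by (auto simp: eventually_sequentially)
  \<comment> \<open>Restricting to \<open>G K\<close> replaces the possibly infinite mean of the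
    norm by a finite one; the price is the complement, of probability below 1/16.\<close>
  define u where "u n \<omega> = norm (psum Xs n \<omega>) * indicator (G K) \<omega>" for n \<omega>
  have [measurable]: "u n \<in> borel_measurable M" for n unfolding u_def[abs_def] by measurable
  define A where "A n = (\<integral>\<^sup>+ \<omega>. ennreal (u n \<omega>) \<partial>M)" for n
  have "(\<Sum>n. ennreal (wt a n) * A n) = (\<integral>\<^sup>+ \<omega>. (\<Sum>n. ennreal (wt a n) * ennreal (u n \<omega>)) \<partial>M)"
    unfolding A_def by (simp add: nn_integral_suminf nn_integral_cmult)
  also have "\<dots> \<le> (\<integral>\<^sup>+ \<omega>. of_nat K \<partial>M)"
  proof (intro nn_integral_mono)
    fix \<omega>
    show "(\<Sum>n. ennreal (wt a n) * ennreal (u n \<omega>)) \<le> of_nat K"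
      by (auto simp: u_def indicator_def G_def V_def ennreal_mult)
  qed
  also have "\<dots> = of_nat K" by (simp add: emeasure_space_1)
  finally have sum_le: "(\<Sum>n. ennreal (wt a n) * A n) \<le> of_nat K" .
  then have sum_fin: "(\<Sum>n. ennreal (wt a n) * A n) < \<infinity>"
    using of_nat_less_top order.strict_trans1 by fastforce
  \<comment> \<open>\<open>enn2real\<close> maps infinity to 0, so \<open>q\<close> would be
    meaningless without this. Positivity of the weight handles n \<ge> 1; at n = 0 the partial sum
    is 0.\<close>
  have A_fin: "A n < \<infinity>" for n
  proof (cases "n = 0")
    case True
    then show ?thesis by (simp add: A_def u_def psum_def)
  next
    case False
    then have "0 < wt a n" by (simp add: wt_def)
    moreover have "ennreal (wt a n) * A n < \<infinity>" using sum_fin by (rule ennreal_suminf_lessD)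
    ultimately show ?thesis by (auto simp: ennreal_mult_less_top)
  qed
  \<comment> \<open>The factor 16 makes Markov's bound 1/16, matching the probability lost outside
    \<open>G K\<close>; together they give 1/8.\<close>
  define q where "q n = 16 * enn2real (A n)" for n
  have "prob {\<omega> \<in> space M. q n < norm (psum Xs n \<omega>)} \<le> 1 / 8" for n
  proof -
    have "prob {\<omega> \<in> space M. q n < norm (psum Xs n \<omega>)}
        \<le> prob ({\<omega> \<in> space M. q n < u n \<omega>} \<union> (space M - G K))"
      by (intro finite_measure_mono) (auto simp: u_def indicator_def)
    also have "\<dots> \<le> prob {\<omega> \<in> space M. q n < u n \<omega>} + prob (space M - G K)"
      by (intro measure_Un_le) auto
    also have "\<dots> \<le> 1 / 16 + 1 / 16"
    proof (intro add_mono)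
      show "prob {\<omega> \<in> space M. q n < u n \<omega>} \<le> 1 / 16"
        unfolding q_def A_def using A_fin[of n] 
        by (intro prob_gt_enn2real_Markov) (auto simp: u_def A_def)
      show "prob (space M - G K) \<le> 1 / 16" using K by (subst prob_compl) auto
    qed
    finally show ?thesis by simp
  qed
  moreover have "(\<Sum>n. ennreal (wt a n * q n)) < \<infinity>"
  proof -
    have "ennreal (wt a n * q n) = 16 * (ennreal (wt a n) * A n)" for n
    proof -
      have "ennreal (wt a n * q n) = ennreal (wt a n) * (ennreal 16 * ennreal (enn2real (A n)))"
        by (simp add: q_def ennreal_mult)
      then show ?thesis using A_fin[of n] by (simp add: mult_ac)
    qed
    then show ?thesis using sum_fin by (simp add: ennreal_mult_less_top)
  qed
  ultimately show ?thesis by (intro exI[of _ q]) (auto simp: q_def)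
qed

text \<open>A pigeonhole argument: for each j \<le> m some n in [m, 2m) has
  \<open>q n + q (n + j)\<close> at most its average over that range. The suitable n depends on j,
  the bound \<open>r m\<close> does not, and such uniformity is what Ottaviani's inequality
  requires.\<close>

lemma exists_rmax_quantile_sequence:
  assumes a: "0 \<le> a" "a \<le> 1"
    and fin: "AE \<omega> in M. (\<Sum>n. ennreal (wt a n * norm (psum Xs n \<omega>))) < \<infinity>"
  shows "\<exists>r. (\<forall>m. 0 \<le> r m) \<and> (\<Sum>m. ennreal (wt a m * r m)) < \<infinity> \<and>
    (\<forall>m\<ge>1. prob {\<omega> \<in> space M. 2 * r m < rmax m \<omega>} \<le> 1 / 2)"
proof -
  obtain q where q: "\<And>n. 0 \<le> q n" and q_fin: "(\<Sum>n. ennreal (wt a n * q n)) < \<infinity>"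
    and qP: "\<And>n. prob {\<omega> \<in> space M. q n < norm (psum Xs n \<omega>)} \<le> 1 / 8"
    using exists_quantile_sequence[OF fin] by blast
  \<comment> \<open>The window reaches to 3m because n + j < 3m. The factor 2 appears because the
    sums of \<open>q n\<close> and of \<open>q (n + j)\<close> are each bounded by the sum over the
    whole window.\<close>
  define r where "r m = 2 / real m * (\<Sum>n=m..<3*m. q n)" for m
  have r0: "0 \<le> r m" for m unfolding r_def using q by (intro mult_nonneg_nonneg sum_nonneg) auto
  have r_fin: "(\<Sum>m. ennreal (wt a m * r m)) < \<infinity>"
  proof -
    have "(\<Sum>m. ennreal (wt a m * r m)) \<le> 54 * (\<Sum>n. ennreal (wt a n * q n))"
      unfolding r_def by (rule suminf_wt_window_average_le[OF a q])
    also have "\<dots> < \<infinity>" using q_fin by (simp add: ennreal_mult_less_top)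
    finally show ?thesis .
  qed
  have le: "prob {\<omega> \<in> space M. r m < norm (psum Xs j \<omega>)} \<le> 1 / 4" if m: "1 \<le> m" and j: "j \<le> m" for m j
  proof -
    have "\<exists>n\<in>{m..<2*m}. q n + q (n + j) \<le> r m"
    proof (rule ccontr)
      assume "\<not> ?thesis"
      then have "(\<Sum>n=m..<2*m. r m) < (\<Sum>n=m..<2*m. q n + q (n + j))"
        using m by (intro sum_strict_mono) (auto simp: not_le)
      also have "\<dots> = (\<Sum>n=m..<2*m. q n) + (\<Sum>n=m+j..<2*m+j. q n)"
        by (simp add: sum.distrib sum.shift_bounds_nat_ivl)
      also have "\<dots> \<le> (\<Sum>n=m..<3*m. q n) + (\<Sum>n=m..<3*m. q n)"
        using q j by (intro add_mono sum_mono2) auto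
      also have "\<dots> = real m * r m" using m by (simp add: r_def)
      finally show False by simp
    qed
    then obtain n where n: "q n + q (n + j) \<le> r m" by blast
    have "prob {\<omega> \<in> space M. r m < norm (psum Xs j \<omega>)}
        = prob {\<omega> \<in> space M. r m < norm (psum Xs (n + j) \<omega> - psum Xs n \<omega>)}"
      by (rule prob_psum_diff[symmetric])
    also have "\<dots> \<le> prob ({\<omega> \<in> space M. q (n + j) < norm (psum Xs (n + j) \<omega>)}
        \<union> {\<omega> \<in> space M. q n < norm (psum Xs n \<omega>)})"
    proof (intro finite_measure_mono subsetI)
      fix \<omega> assume "\<omega> \<in> {\<omega> \<in> space M. r m < norm (psum Xs (n + j) \<omega> - psum Xs n \<omega>)}"
      then show "\<omega> \<in> {\<omega> \<in> space M. q (n + j) < norm (psum Xs (n + j) \<omega>)} \<union> {\<omega> \<in> space M. q n < norm (psum Xs n \<omega>)}"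
        using n norm_triangle_ineq4[of "psum Xs (n + j) \<omega>" "psum Xs n \<omega>"] by auto
    qed measurable
    also have "\<dots> \<le> 1 / 8 + 1 / 8"
      using qP[of "n + j"] qP[of n] by (intro order.trans[OF measure_Un_le] add_mono) auto
    finally show ?thesis by simp
  qed
  have "prob {\<omega> \<in> space M. 2 * r m < rmax m \<omega>} \<le> 1 / 2" if "1 \<le> m" for m
    using Ottaviani[OF le[OF that]] by simp
  with r0 r_fin show ?thesis by blast
qed

text \<open>The third claim concerns maxima rather than norms because it serves two ends: it
  dominates the series of expected norms, and it is the input to the strong law.\<close>

lemma AE_summable_imp:
  assumes a: "0 < a" "a < 1"
    and fin: "AE \<omega> in M. (\<Sum>n. ennreal (wt a n * norm (psum Xs n \<omega>))) < \<infinity>"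
  shows "integrable M (Xs 0)"
    and "(\<integral>\<^sup>+ t. indicator {0..} t * ennreal (prob {\<omega> \<in> space M. t < norm (Xs 0 \<omega>)} powr a) \<partial>lborel) < \<infinity>"
    and "(\<Sum>m. ennreal (wt a m) * (\<integral>\<^sup>+ \<omega>. ennreal (rmax m \<omega>) \<partial>M)) < \<infinity>"
proof -
  obtain r where r: "\<And>m. 0 \<le> r m" and r_fin: "(\<Sum>m. ennreal (wt a m * r m)) < \<infinity>"
    and half: "\<And>m. 1 \<le> m \<Longrightarrow> prob {\<omega> \<in> space M. 2 * r m < rmax m \<omega>} \<le> 1 / 2"
    using exists_rmax_quantile_sequence[OF less_imp_le[OF a(1)] less_imp_le[OF a(2)] fin] by blast
  define f where "f t = prob {\<omega> \<in> space M. t < norm (Xs 0 \<omega>)}" for t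
  have f: "0 \<le> f t" "f t \<le> 1" for t by (simp_all add: f_def)
  have anti: "f y \<le> f x" if "x \<le> y" for x y
    unfolding f_def using that by (intro finite_measure_mono) auto
  have [measurable]: "f \<in> borel_measurable borel"
    unfolding f_def by measurable
  have fr: "f (4 * r m) \<le> 1 / real m" if "1 \<le> m" for m
    unfolding f_def using half[OF that] that by (rule prob_norm_gt_le)
  have r8_fin: "(\<Sum>m. ennreal (wt a m * (c * r m))) < \<infinity>" if "0 \<le> c" for c
  proof -
    have "ennreal (wt a m * (c * r m)) = ennreal c * ennreal (wt a m * r m)" for m
      using that r by (simp add: ennreal_mult[symmetric] mult_ac)
    then show ?thesis using r_fin by (simp add: ennreal_mult_less_top)
  qed
  have "(\<integral>\<^sup>+ t. indicator {0..} t * ennreal (f t powr a) \<partial>lborel) \<le> 8 * (\<Sum>m. ennreal (wt a m * (4 * r m)))"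
    using a f anti r fr by (intro nn_integral_tail_powr_le) auto
  also have "\<dots> < \<infinity>" using r8_fin[of 4] by (simp add: ennreal_mult_less_top)
  finally have tail: "(\<integral>\<^sup>+ t. indicator {0..} t * ennreal (f t powr a) \<partial>lborel) < \<infinity>" .
  then show "(\<integral>\<^sup>+ t. indicator {0..} t * ennreal (prob {\<omega> \<in> space M. t < norm (Xs 0 \<omega>)} powr a) \<partial>lborel) < \<infinity>"
    by (simp add: f_def)
  \<comment> \<open>Integrability must precede the estimate for the maxima, whose absorption step
    relies on it. It follows from the tail integral because f \<le> 1 and a < 1 give f \<le> f powr
    a.\<close>
  have "(\<integral>\<^sup>+ \<omega>. ennreal (norm (Xs 0 \<omega>) - 0) \<partial>M) = (\<integral>\<^sup>+ t. indicator {0..} t * ennreal (f t) \<partial>lborel)"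
    unfolding f_def by (rule nn_integral_layer_cake) measurable
  also have "\<dots> \<le> (\<integral>\<^sup>+ t. indicator {0..} t * ennreal (f t powr a) \<partial>lborel)"
  proof (intro nn_integral_mono mult_left_mono ennreal_leI)
    fix t show "f t \<le> f t powr a"
      using powr_mono'[of a 1 "f t"] f[of t] a by simp
  qed simp
  also note tail
  finally show int: "integrable M (Xs 0)" by (simp add: integrable_iff_bounded)
  have "(\<Sum>m. ennreal (wt a m) * (\<integral>\<^sup>+ \<omega>. ennreal (rmax m \<omega>) \<partial>M))
    \<le> (\<Sum>m. 2 * (ennreal (wt a m * (8 * r m)) + ennreal (wt a m * real m) * (\<integral>\<^sup>+ t. indicator {4 * r m..} t * ennreal (f t) \<partial>lborel)))"
  proof (intro suminf_le)
    fix m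
    show "ennreal (wt a m) * (\<integral>\<^sup>+ \<omega>. ennreal (rmax m \<omega>) \<partial>M)
      \<le> 2 * (ennreal (wt a m * (8 * r m)) + ennreal (wt a m * real m) * (\<integral>\<^sup>+ t. indicator {4 * r m..} t * ennreal (f t) \<partial>lborel))"
    proof (cases "m = 0")
      case False
      have "(\<integral>\<^sup>+ \<omega>. ennreal (norm (Xs 0 \<omega>) - 4 * r m) \<partial>M) = (\<integral>\<^sup>+ t. indicator {4 * r m..} t * ennreal (f t) \<partial>lborel)"
        unfolding f_def by (rule nn_integral_layer_cake) measurable
      then have "(\<integral>\<^sup>+ \<omega>. ennreal (rmax m \<omega>) \<partial>M)
        \<le> 2 * (ennreal (8 * r m) + of_nat m * (\<integral>\<^sup>+ t. indicator {4 * r m..} t * ennreal (f t) \<partial>lborel))"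
        using nn_integral_rmax_le[OF half r int, of m] False by simp
      then have "ennreal (wt a m) * (\<integral>\<^sup>+ \<omega>. ennreal (rmax m \<omega>) \<partial>M)
        \<le> ennreal (wt a m) * (2 * (ennreal (8 * r m) + of_nat m * (\<integral>\<^sup>+ t. indicator {4 * r m..} t * ennreal (f t) \<partial>lborel)))"
        by (rule mult_left_mono) simp
      also have "\<dots> = 2 * (ennreal (wt a m * (8 * r m)) + ennreal (wt a m * real m) * (\<integral>\<^sup>+ t. indicator {4 * r m..} t * ennreal (f t) \<partial>lborel))"
      proof -
        have "ennreal (wt a m * (8 * r m)) = ennreal (wt a m) * ennreal (8 * r m)"
          "ennreal (wt a m * real m) = ennreal (wt a m) * of_nat m"
          using r by (simp_all only: ennreal_mult ennreal_of_nat_eq_real_of_nat wt_nonneg of_nat_0_le_iff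
              mult_nonneg_nonneg zero_le_numeral)
        then show ?thesis by (simp only: distrib_left mult_ac)
      qed
      finally show ?thesis .
    qed simp
  qed (auto simp: summableI)
  also have "\<dots> = 2 * ((\<Sum>m. ennreal (wt a m * (8 * r m))) + (\<Sum>m. ennreal (wt a m * real m) * (\<integral>\<^sup>+ t. indicator {4 * r m..} t * ennreal (f t) \<partial>lborel)))"
    by (simp only: ennreal_suminf_cmult suminf_add[OF summableI summableI])
  also have "\<dots> < \<infinity>"
  proof -
    have "(\<Sum>m. ennreal (wt a m * real m) * (\<integral>\<^sup>+ t. indicator {4 * r m..} t * ennreal (f t) \<partial>lborel))
      \<le> ennreal (1 / (1 - a)) * (\<integral>\<^sup>+ t. indicator {0..} t * ennreal (f t powr a) \<partial>lborel)"
      using a f anti r fr by (intro suminf_wt_tail_le) auto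
    also have "\<dots> < \<infinity>" using tail by (simp add: ennreal_mult_less_top)
    finally show ?thesis using r8_fin[of 8] by (simp add: ennreal_mult_less_top)
  qed
  finally show "(\<Sum>m. ennreal (wt a m) * (\<integral>\<^sup>+ \<omega>. ennreal (rmax m \<omega>) \<partial>M)) < \<infinity>" .
qed

section \<open>The strong law and the vanishing of the mean\<close>

lemma AE_rmax_tendsto_0:
  assumes a: "0 \<le> a" "a \<le> 1"
    and fin: "(\<Sum>m. ennreal (wt a m) * (\<integral>\<^sup>+ \<omega>. ennreal (rmax m \<omega>) \<partial>M)) < \<infinity>"
  shows "AE \<omega> in M. (\<lambda>n. rmax n \<omega> * real n powr (- a)) \<longlonglongrightarrow> 0"
proof -
  have "(\<integral>\<^sup>+ \<omega>. (\<Sum>m. ennreal (wt a m * rmax m \<omega>)) \<partial>M) < \<infinity>"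
    using fin by (simp add: nn_integral_suminf nn_integral_cmult ennreal_mult rmax_nonneg)
  then have "AE \<omega> in M. (\<Sum>m. ennreal (wt a m * rmax m \<omega>)) \<noteq> \<infinity>"
    by (intro nn_integral_PInf_AE) auto
  then show ?thesis
  proof eventually_elim
    case (elim \<omega>)
    then show ?case
      using a rmax_nonneg mono_rmax by (intro mono_wt_suminf_tendsto_0) (auto simp: less_top)
  qed
qed

text \<open>The mean norm of the m-th sum is at least m times the norm of the mean of
  \<open>Xs 0\<close>. This lower bound is monotone in m, so a finite weighted series would force
  m^(1-a) times that norm to 0, which for a < 1 is impossible unless the norm is 0.\<close>

lemma expectation_eq_0_if_suminf_finite:
  assumes a: "0 \<le> a" "a < 1" and int: "integrable M (Xs 0)"
    and fin: "(\<Sum>m. ennreal (wt a m) * (\<integral>\<^sup>+ \<omega>. ennreal (norm (psum Xs m \<omega>)) \<partial>M)) < \<infinity>"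
  shows "expectation (Xs 0) = 0"
proof (rule ccontr)
  let ?e = "norm (expectation (Xs 0))"
  assume "expectation (Xs 0) \<noteq> 0"
  then have e: "0 < ?e" by simp
  have intk: "integrable M (Xs k)" and Ek: "expectation (Xs k) = expectation (Xs 0)" for k
  proof -
    have "integrable (distr M borel (Xs k)) (\<lambda>x. x)"
      unfolding ident[of k] using int by (simp add: integrable_distr_eq)
    then show "integrable M (Xs k)" by (simp add: integrable_distr_eq)
    have "expectation (Xs k) = integral\<^sup>L (distr M borel (Xs k)) (\<lambda>x. x)"
      by (simp add: integral_distr)
    also have "\<dots> = expectation (Xs 0)" unfolding ident[of k] by (simp add: integral_distr)
    finally show "expectation (Xs k) = expectation (Xs 0)" .
  qed
  have le: "ennreal (real m * ?e) \<le> (\<integral>\<^sup>+ \<omega>. ennreal (norm (psum Xs m \<omega>)) \<partial>M)" for m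
  proof -
    have "expectation (psum Xs m) = (\<Sum>k<m. expectation (Xs k))"
      unfolding psum_def[abs_def] using intk by (intro Bochner_Integration.integral_sum) auto
    also have "\<dots> = (\<Sum>k<m. expectation (Xs 0))" by (intro sum.cong refl Ek)
    also have "\<dots> = real m *\<^sub>R expectation (Xs 0)" by (simp add: sum_constant_scaleR)
    finally have "real m * ?e = norm (expectation (psum Xs m))" by simp
    also have "ennreal \<dots> \<le> (\<integral>\<^sup>+ \<omega>. ennreal (norm (psum Xs m \<omega>)) \<partial>M)"
      using intk by (intro integral_norm_bound_ennreal) (auto simp: psum_def[abs_def])
    finally show ?thesis .
  qed
  have "(\<Sum>m. ennreal (wt a m * (real m * ?e))) \<le> (\<Sum>m. ennreal (wt a m) * (\<integral>\<^sup>+ \<omega>. ennreal (norm (psum Xs m \<omega>)) \<partial>M))"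
    using le by (intro suminf_le) (auto simp: ennreal_mult mult_left_mono summableI)
  also note fin
  finally have "(\<lambda>m. real m * ?e * real m powr (- a)) \<longlonglongrightarrow> 0"
    using a e by (intro mono_wt_suminf_tendsto_0) (auto intro!: monoI mult_right_mono)
  then have "\<forall>\<^sub>F m in sequentially. real m * ?e * real m powr (- a) < ?e"
    using e by (rule order_tendstoD)
  then have "\<forall>\<^sub>F m in sequentially. False"
    using eventually_ge_at_top[of 1]
  proof eventually_elim
    case (elim m)
    have "1 \<le> real m powr (1 - a)" using elim(2) a by (intro ge_one_powr_ge_zero) auto
    also have "\<dots> = real m * real m powr (- a)"
      using elim(2) powr_add[of "real m" 1 "- a"] by simp
    finally have "1 * ?e \<le> real m * real m powr (- a) * ?e" using e by (intro mult_right_mono) auto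
    then show ?case using elim(1) by (simp add: mult_ac)
  qed
  then show False by simp
qed

end

text \<open>The expected series is taken in \<open>ennreal\<close>, where infinite means of the
  norms are allowed. The mean of \<open>X\<close> is a Bochner integral; together with integrability
  this yields the Pettis integral as well. \<open>X\<close> is tied to the sequence only through its
  law, so mean and tail are carried over from \<open>Xs 0\<close>.\<close>

theorem theorem2p1:
  fixes M :: "'a measure"
    and X :: "'a \<Rightarrow> 'b::{banach, second_countable_topology}"
    and Xs :: "nat \<Rightarrow> 'a \<Rightarrow> 'b"
    and p :: real
  assumes "prob_space M"
    and "1 < p" and "p < 2"
    and "X \<in> borel_measurable M"
    and "\<And>i. Xs i \<in> borel_measurable M"
    and "prob_space.indep_vars M (\<lambda>_. borel) Xs UNIV"
    and "\<And>i. distr M borel (Xs i) = distr M borel X"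
  shows
    "((\<Sum>n. ennreal (1 / real (Suc n)) *
             ((\<integral>\<^sup>+ \<omega>. ennreal (norm (psum Xs (Suc n) \<omega>)) \<partial>M) / ennreal (real (Suc n) powr (1 / p))))
        < \<infinity>
      \<longleftrightarrow>
      (AE \<omega> in M. summable (\<lambda>n. (1 / real (Suc n)) *
             (norm (psum Xs (Suc n) \<omega>) / real (Suc n) powr (1 / p)))))
   \<and>
    (((\<Sum>n. ennreal (1 / real (Suc n)) *
             ((\<integral>\<^sup>+ \<omega>. ennreal (norm (psum Xs (Suc n) \<omega>)) \<partial>M) / ennreal (real (Suc n) powr (1 / p))))
        < \<infinity>
      \<or>
      (AE \<omega> in M. summable (\<lambda>n. (1 / real (Suc n)) *
             (norm (psum Xs (Suc n) \<omega>) / real (Suc n) powr (1 / p)))))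
     \<longrightarrow>
      (integrable M X \<and> integral\<^sup>L M X = 0)
      \<and> (\<integral>\<^sup>+ t. indicator {0..} t *
             ennreal (measure M {\<omega> \<in> space M. norm (X \<omega>) > t} powr (1 / p)) \<partial>lborel) < \<infinity>
      \<and> (AE \<omega> in M. (\<lambda>n. (1 / real (Suc n) powr (1 / p)) *\<^sub>R psum Xs (Suc n) \<omega>)
                        \<longlonglongrightarrow> 0))"
proof -
  note [measurable] = \<open>X \<in> borel_measurable M\<close>
  interpret prob_space M by fact
  interpret iid_sequence M Xs
    by unfold_locales (use assms(5-7) in auto)
  define a where "a = 1 / p"
  have a: "0 < a" "a < 1" using assms(2) by (auto simp: a_def)
  have wt_Suc: "wt a (Suc n) * x = 1 / real (Suc n) * (x / real (Suc n) powr (1 / p))" for n x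
    using powr_diff[of "real (Suc n)" "-1" "1 / p"] by (simp add: wt_def a_def powr_minus_divide)
  let ?E = "(\<Sum>n. ennreal (1 / real (Suc n)) *
             ((\<integral>\<^sup>+ \<omega>. ennreal (norm (psum Xs (Suc n) \<omega>)) \<partial>M) / ennreal (real (Suc n) powr (1 / p))))"
  let ?S = "\<lambda>\<omega>. summable (\<lambda>n. (1 / real (Suc n)) *
             (norm (psum Xs (Suc n) \<omega>) / real (Suc n) powr (1 / p)))"
  have E_eq: "?E = (\<Sum>m. ennreal (wt a m) * (\<integral>\<^sup>+ \<omega>. ennreal (norm (psum Xs m \<omega>)) \<partial>M))"
  proof -
    have "ennreal (1 / real (Suc n)) * (I / ennreal (real (Suc n) powr (1 / p))) = ennreal (wt a (Suc n)) * I"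
      for n and I :: ennreal
    proof -
      have "I / ennreal (real (Suc n) powr (1 / p)) = ennreal (1 / real (Suc n) powr (1 / p)) * I"
        by (simp add: divide_ennreal_def inverse_ennreal inverse_eq_divide mult.commute)
      then have "ennreal (1 / real (Suc n)) * (I / ennreal (real (Suc n) powr (1 / p)))
          = ennreal (1 / real (Suc n)) * ennreal (1 / real (Suc n) powr (1 / p)) * I"
        by (simp only: mult.assoc)
      also have "\<dots> = ennreal (wt a (Suc n)) * I"
        using wt_Suc[of n 1] by (simp add: ennreal_mult[symmetric])
      finally show ?thesis .
    qed
    then have "?E = (\<Sum>n. ennreal (wt a (Suc n)) * (\<integral>\<^sup>+ \<omega>. ennreal (norm (psum Xs (Suc n) \<omega>)) \<partial>M))"
      by (simp only:)
    also have "\<dots> = (\<Sum>m. ennreal (wt a m) * (\<integral>\<^sup>+ \<omega>. ennreal (norm (psum Xs m \<omega>)) \<partial>M))"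
      by (rule ennreal_suminf_Suc) simp
    finally show ?thesis .
  qed
  have S_eq: "?S \<omega> \<longleftrightarrow> (\<Sum>n. ennreal (wt a n * norm (psum Xs n \<omega>))) < \<infinity>" for \<omega>
  proof -
    have "?S \<omega> \<longleftrightarrow> summable (\<lambda>n. wt a (Suc n) * norm (psum Xs (Suc n) \<omega>))"
      by (simp only: wt_Suc)
    also have "\<dots> \<longleftrightarrow> summable (\<lambda>n. wt a n * norm (psum Xs n \<omega>))"
      by (rule summable_Suc_iff)
    also have "\<dots> \<longleftrightarrow> (\<Sum>n. ennreal (wt a n * norm (psum Xs n \<omega>))) < \<infinity>"
      using summable_suminf_not_top[of "\<lambda>n. wt a n * norm (psum Xs n \<omega>)"]
        ennreal_suminf_neq_top[of "\<lambda>n. wt a n * norm (psum Xs n \<omega>)"]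
      by (auto simp only: less_top infinity_ennreal_def wt_nonneg mult_nonneg_nonneg norm_ge_zero)
    finally show ?thesis .
  qed
  have E_imp_S: "AE \<omega> in M. ?S \<omega>" if "?E < \<infinity>"
  proof -
    have "(\<integral>\<^sup>+ \<omega>. (\<Sum>n. ennreal (wt a n * norm (psum Xs n \<omega>))) \<partial>M) < \<infinity>"
      using that unfolding E_eq by (simp add: nn_integral_suminf nn_integral_cmult ennreal_mult)
    then have "AE \<omega> in M. (\<Sum>n. ennreal (wt a n * norm (psum Xs n \<omega>))) \<noteq> \<infinity>"
      by (intro nn_integral_PInf_AE) auto
    then show ?thesis unfolding S_eq by (simp add: less_top)
  qed
  \<comment> \<open>All conclusions, finiteness of the expected series included, are drawn from
    almost sure summability. The other hypothesis reduces to it by Tonelli, so this one implication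
    serves both the equivalence and the consequences.\<close>
  have S_imp: "?E < \<infinity> \<and> (integrable M X \<and> integral\<^sup>L M X = 0)
      \<and> (\<integral>\<^sup>+ t. indicator {0..} t *
             ennreal (measure M {\<omega> \<in> space M. norm (X \<omega>) > t} powr (1 / p)) \<partial>lborel) < \<infinity>
      \<and> (AE \<omega> in M. (\<lambda>n. (1 / real (Suc n) powr (1 / p)) *\<^sub>R psum Xs (Suc n) \<omega>) \<longlonglongrightarrow> 0)"
    if S: "AE \<omega> in M. ?S \<omega>"
  proof -
    note main = AE_summable_imp[OF a S[unfolded S_eq]]
    have "?E \<le> (\<Sum>m. ennreal (wt a m) * (\<integral>\<^sup>+ \<omega>. ennreal (rmax m \<omega>) \<partial>M))"
      unfolding E_eq
      by (intro suminf_le mult_left_mono nn_integral_mono ennreal_leI norm_psum_le_rmax) (auto simp: summableI)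
    also note main(3)
    finally have E: "?E < \<infinity>" .
    have distr: "distr M borel (Xs 0) = distr M borel X" by fact
    have "integrable (distr M borel X) (\<lambda>x. x)"
      unfolding distr[symmetric] using main(1) by (simp add: integrable_distr_eq)
    then have int: "integrable M X" by (simp add: integrable_distr_eq)
    have "expectation X = integral\<^sup>L (distr M borel X) (\<lambda>x. x)" by (simp add: integral_distr)
    also have "\<dots> = expectation (Xs 0)" unfolding distr[symmetric] by (simp add: integral_distr)
    also have "\<dots> = 0"
      using less_imp_le[OF a(1)] a(2) main(1) E[unfolded E_eq] by (rule expectation_eq_0_if_suminf_finite)
    finally have EX: "expectation X = 0" .
    have "prob {\<omega> \<in> space M. t < norm (Y \<omega>)} = measure (distr M borel Y) {x. t < norm x}"
      if [measurable]: "Y \<in> borel_measurable M" for Y :: "'a \<Rightarrow> 'b" and t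
      by (subst measure_distr) (auto intro!: arg_cong[where f=prob])
    from this[of "Xs 0"] this[of X]
    have "prob {\<omega> \<in> space M. t < norm (X \<omega>)} = prob {\<omega> \<in> space M. t < norm (Xs 0 \<omega>)}" for t
      by (simp add: distr)
    then have tail: "(\<integral>\<^sup>+ t. indicator {0..} t *
             ennreal (measure M {\<omega> \<in> space M. norm (X \<omega>) > t} powr (1 / p)) \<partial>lborel) < \<infinity>"
      using main(2) by (simp add: a_def)
    have "AE \<omega> in M. (\<lambda>n. rmax n \<omega> * real n powr (- a)) \<longlonglongrightarrow> 0"
      using a main(3) by (intro AE_rmax_tendsto_0) auto
    then have "AE \<omega> in M. (\<lambda>n. (1 / real (Suc n) powr (1 / p)) *\<^sub>R psum Xs (Suc n) \<omega>) \<longlonglongrightarrow> 0"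
    proof eventually_elim
      case (elim \<omega>)
      then have "(\<lambda>n. rmax (Suc n) \<omega> * real (Suc n) powr (- a)) \<longlonglongrightarrow> 0"
        by (rule LIMSEQ_Suc)
      then show ?case
      proof (rule Lim_null_comparison[rotated], intro always_eventually allI)
        fix n
        have "norm ((1 / real (Suc n) powr (1 / p)) *\<^sub>R psum Xs (Suc n) \<omega>)
            = norm (psum Xs (Suc n) \<omega>) * real (Suc n) powr (- a)"
          by (simp add: a_def powr_minus_divide)
        also have "\<dots> \<le> rmax (Suc n) \<omega> * real (Suc n) powr (- a)"
          by (intro mult_right_mono norm_psum_le_rmax) auto
        finally show "norm ((1 / real (Suc n) powr (1 / p)) *\<^sub>R psum Xs (Suc n) \<omega>)
            \<le> rmax (Suc n) \<omega> * real (Suc n) powr (- a)" .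
      qed
    qed
    with E int EX tail show ?thesis by blast
  qed
  show ?thesis using E_imp_S S_imp by blast
qed

end
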